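(* Let $N_2$ be a predefined constant and let $\delta_1,\dots,\delta_{N_2}\in\Omega$ be sampled uncertainties, $\Omega_{N_2}=\{\delta_1,\dots,\delta_{N_2}\}$. The maximum expected loss $$\gamma_{RA}(N_2)=\sup_{a\in\ell_{2e}}\ \frac1{N_2}\sum_{i=1}^{N_2}\|y_p(\delta_i)\|_{\ell_2}^2\quad\text{s.t.}\quad \|y_r(\delta)\|_{\ell_2}^2\le1\ \text{ and }\ x(\delta)[\infty]=0\quad\forall\,\delta\in\Omega_{N_2}$$ equals the optimal value of the convex semidefinite program $$\min_{\gamma\ge0,\;P=P^T}\ \mathbf{1}^T\begin{bmatrix}\gamma_1&\dots&\gamma_{N_2}\end{bmatrix}^T\quad\text{s.t.}\quad \begin{bmatrix}\bar A^TP\bar A-P&\bar A^TP\bar B\\ \bar B^TP\bar A&\bar B^TP\bar B\end{bmatrix}+\Psi(\gamma)\preceq0,$$ where $\gamma\in\mathbb{R}^{N_2}$, $\gamma\ge 0$ is understood elementwise, $$\Psi(\gamma)=\frac1{N_2}\begin{bmatrix}\bar C_p^T\\ \bar D_p^T\end{bmatrix}\begin{bmatrix}\bar C_p&\bar D_p\end{bmatrix}-\begin{bmatrix}\bar C_r^T\\ \bar D_r^T\end{bmatrix}\Gamma(\gamma)\begin{bmatrix}\bar C_r&\bar D_r\end{bmatrix},\qquad \Gamma(\gamma)=\mathrm{diag}(\gamma_1,\dots,\gamma_{N_2})\otimes I_{n_r},$$ $\bar A=\mathrm{blkdiag}(A_{cl,1},\dots,A_{cl,N_2})$, $\bar C_p=\mathrm{blkdiag}(C_{p,1},\dots,C_{p,N_2})$,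 $\bar C_r=\mathrm{blkdiag}(C_{r,1},\dots,C_{r,N_2})$, and $\bar B,\bar D_p,\bar D_r$ are obtained by stacking vertically $B_{cl,1},\dots,B_{cl,N_2}$, respectively $D_{p,1},\dots,D_{p,N_2}$, respectively $D_{r,1},\dots,D_{r,N_2}$.
   Context: Uncertainty: $\Omega\subset\mathbb{R}^v$ is closed, bounded and contains $0$. Signals: $\ell_{2e}$ is the set of discrete-time signals $a:\mathbb{Z}^+\to\mathbb{R}^{n_a}$ ($\mathbb{Z}^+$ the non-negative integers) with $\sum_{k=0}^N a[k]^Ta[k]<\infty$ for all $N\in\mathbb{Z}^+$; $\|y\|_{\ell_2}^2=\sum_{k=0}^\infty y[k]^Ty[k]$; $x[\infty]=\lim_{k\to\infty}x[k]$. System: for each $\delta\in\Omega$ and attack signal $a$, the closed-loop system is $$x[k+1]=A_{cl}^\Delta x[k]+B_{cl}^\Delta a[k],\quad y_p[k]=C_p^\Delta x[k]+D_p^\Delta a[k],\quad y_r[k]=C_r^\Delta x[k]+D_r^\Delta a[k],\quad x[0]=0,$$ with state $x(\delta)\in\mathbb{R}^{n_c}$, performance output $y_p(\delta)\in\mathbb{R}^{n_p}$ and residual output $y_r(\delta)\in\mathbb{R}^{n_r}$ (all also depending on $a$). The real matrices depend on $\delta$ and are obtained from $$A_{cl}=\begin{bmatrix} A+BD_cC & BC_c & 0 \\ B_cC & A_c & 0 \\ (B_eD_c+K_e)C & B_eC_c & A_e \end{bmatrix},\quad B_{cl}=\begin{bmatrix} BB_a+BD_cD_a \\ B_cD_a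 \\ (B_eD_c+K_e)D_a \end{bmatrix},$$ $$C_p=\begin{bmatrix}C_J+D_JD_cC&D_JC_c&0\end{bmatrix},\ D_p=D_J(D_cD_a+B_a),\ C_r=\begin{bmatrix}(D_eD_c+E_e)C&D_eC_c&C_e\end{bmatrix},\ D_r=(D_eD_c+E_e)D_a$$ by replacing each of the plant matrices $A,B,C,C_J,D_J$, controller matrices $A_c,B_c,C_c,D_c$ and detector matrices $A_e,B_e,K_e,C_e,D_e,E_e$, generically $X$, by $X+\Delta X(\delta)$ with $\Delta X(0)=0$. The fixed 0/1 matrices $B_a,D_a$ indicate the attacked actuator and sensor channels (either actuators or sensors are attacked, not both). The subscript $i$ (as in $A_{cl,i},B_{cl,i},C_{p,i},D_{p,i},C_{r,i},D_{r,i}$) denotes the value of the closed-loop matrix at $\delta=\delta_i$. Standing assumptions: the closed-loop system is stable for every $\delta\in\Omega$, and $B_{cl}^\Delta$ has full column rank. *)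

theory Defs
  imports "HOL-Analysis.Analysis"
begin

section \<open>Block matrices, indexed by sum and product types\<close>

definition hcat :: "real^'c^'r \<Rightarrow> real^'d^'r \<Rightarrow> real^('c::finite + 'd::finite)^'r"  (infixr "<|>" 60)
  where "M <|> N = (\<chi> i j. case j of Inl c \<Rightarrow> M $ i $ c | Inr d \<Rightarrow> N $ i $ d)"

definition vcat :: "real^'c^'r \<Rightarrow> real^'c^'s \<Rightarrow> real^'c^('r::finite + 's::finite)"  (infixr "<#>" 55)
  where "M <#> N = (\<chi> i. case i of Inl r \<Rightarrow> M $ r | Inr s \<Rightarrow> N $ s)"

definition blkdiag :: "('N::finite \<Rightarrow> real^'c^'r) \<Rightarrow> real^('N \<times> 'c::finite)^('N \<times> 'r::finite)"
  where "blkdiag M = (\<chi> p q. if fst p = fst q then M (fst p) $ snd p $ snd q else 0)"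

definition vstack :: "('N::finite \<Rightarrow> real^'c^'r) \<Rightarrow> real^'c^('N \<times> 'r::finite)"
  where "vstack M = (\<chi> p. M (fst p) $ snd p)"

definition diag :: "real^'n \<Rightarrow> real^'n^'n"
  where "diag g = (\<chi> i j. if i = j then g $ i else 0)"

definition kron :: "real^'c^'r \<Rightarrow> real^'d^'s \<Rightarrow> real^('c::finite \<times> 'd::finite)^('r::finite \<times> 's::finite)"
  where "kron M N = (\<chi> p q. M $ fst p $ fst q * N $ snd p $ snd q)"

definition neg_semidef :: "real^'n^'n \<Rightarrow> bool"
  where "neg_semidef M \<longleftrightarrow> transpose M = M \<and> (\<forall>z. z \<bullet> (M *v z) \<le> 0)"


section \<open>Discrete-time signals and linear systems\<close>

text \<open>The sums are taken in the extended reals so that finiteness is a meaningful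
  condition; for discrete-time signals it holds automatically, i.e. every signal is in l2e.\<close>

definition l2e :: "(nat \<Rightarrow> real^'a) set"
  where "l2e = {a. \<forall>N. (\<Sum>k\<le>N. ereal (a k \<bullet> a k)) < \<infinity>}"

definition l2_norm_sq :: "(nat \<Rightarrow> real^'a) \<Rightarrow> ereal"
  where "l2_norm_sq y = (\<Sum>k. ereal (y k \<bullet> y k))"

primrec state_traj ::
  "real^'x^'x \<Rightarrow> real^'a^'x \<Rightarrow> (nat \<Rightarrow> real^'a) \<Rightarrow> nat \<Rightarrow> real^'x"
where
  "state_traj A B a 0 = 0"
| "state_traj A B a (Suc k) = A *v state_traj A B a k + B *v a k"

definition output_traj ::
  "real^'x^'x \<Rightarrow> real^'a^'x \<Rightarrow> real^'x^'y \<Rightarrow> real^'a^'y \<Rightarrow> (nat \<Rightarrow> real^'a) \<Rightarrow> nat \<Rightarrow> real^'y"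
  where "output_traj A B C D a k = C *v state_traj A B a k + D *v a k"

text \<open>Asymptotic stability of \<open>x[k+1] = A x[k]\<close>: Lyapunov stability and attractivity of the
  origin.\<close>

definition asymp_stable :: "real^'x^'x \<Rightarrow> bool"
  where "asymp_stable A \<longleftrightarrow>
    (\<forall>e>0. \<exists>d>0. \<forall>x0. norm x0 < d \<longrightarrow> (\<forall>k. norm (((*v) A ^^ k) x0) < e)) \<and>
    (\<forall>x0. (\<lambda>k. ((*v) A ^^ k) x0) \<longlonglongrightarrow> 0)"


section \<open>Plant, controller and detector\<close>

text \<open>Index types: plant state \<open>'n\<close>, controller state \<open>'c\<close>, detector state \<open>'e\<close>, plant input
  \<open>'u\<close>, measurement \<open>'y\<close>, performance output \<open>'p\<close>, residual \<open>'r\<close>, attack \<open>'a\<close>.\<close>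

record ('n::finite, 'c::finite, 'e::finite, 'u::finite, 'y::finite, 'p::finite, 'r::finite) loop =
  mA  :: "real^'n^'n"
  mB  :: "real^'u^'n"
  mC  :: "real^'n^'y"
  mCJ :: "real^'n^'p"
  mDJ :: "real^'u^'p"
  mAc :: "real^'c^'c"
  mBc :: "real^'y^'c"
  mCc :: "real^'c^'u"
  mDc :: "real^'y^'u"
  mAe :: "real^'e^'e"
  mBe :: "real^'u^'e"
  mKe :: "real^'y^'e"
  mCe :: "real^'e^'r"
  mDe :: "real^'u^'r"
  mEe :: "real^'y^'r"

definition zero_loop ::
    "('n::finite, 'c::finite, 'e::finite, 'u::finite, 'y::finite, 'p::finite, 'r::finite) loop"
  where "zero_loop =
    \<lparr>mA = 0, mB = 0, mC = 0, mCJ = 0, mDJ = 0, mAc = 0, mBc = 0, mCc = 0, mDc = 0,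
     mAe = 0, mBe = 0, mKe = 0, mCe = 0, mDe = 0, mEe = 0\<rparr>"

definition plus_loop ::
    "('n::finite, 'c::finite, 'e::finite, 'u::finite, 'y::finite, 'p::finite, 'r::finite) loop
     \<Rightarrow> ('n, 'c, 'e, 'u, 'y, 'p, 'r) loop \<Rightarrow> ('n, 'c, 'e, 'u, 'y, 'p, 'r) loop"
  where "plus_loop S T =
    \<lparr>mA = mA S + mA T, mB = mB S + mB T, mC = mC S + mC T, mCJ = mCJ S + mCJ T,
     mDJ = mDJ S + mDJ T, mAc = mAc S + mAc T, mBc = mBc S + mBc T, mCc = mCc S + mCc T,
     mDc = mDc S + mDc T, mAe = mAe S + mAe T, mBe = mBe S + mBe T, mKe = mKe S + mKe T,
     mCe = mCe S + mCe T, mDe = mDe S + mDe T, mEe = mEe S + mEe T\<rparr>"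

definition attack_channels :: "real^'a^'u \<Rightarrow> real^'a^'y \<Rightarrow> bool"
  where "attack_channels Ba Da \<longleftrightarrow>
    (\<forall>i j. Ba $ i $ j \<in> {0, 1}) \<and> (\<forall>i j. Da $ i $ j \<in> {0, 1}) \<and> (Ba = 0 \<or> Da = 0)"

definition A_cl :: "('n::finite, 'c::finite, 'e::finite, 'u::finite, 'y::finite, 'p::finite, 'r::finite) loop
    \<Rightarrow> real^('n + 'c + 'e)^('n + 'c + 'e)"
  where "A_cl S =
    ((mA S + mB S ** mDc S ** mC S)           <|> (mB S ** mCc S)  <|> 0) <#>
    ((mBc S ** mC S)                          <|> mAc S            <|> 0) <#>
    (((mBe S ** mDc S + mKe S) ** mC S)       <|> (mBe S ** mCc S) <|> mAe S)"

definition B_cl :: "real^'a^'u \<Rightarrow> real^'a^'y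
    \<Rightarrow> ('n::finite, 'c::finite, 'e::finite, 'u::finite, 'y::finite, 'p::finite, 'r::finite) loop
    \<Rightarrow> real^'a^('n + 'c + 'e)"
  where "B_cl Ba Da S =
    (mB S ** Ba + mB S ** mDc S ** Da) <#>
    (mBc S ** Da) <#>
    ((mBe S ** mDc S + mKe S) ** Da)"

definition C_p :: "('n::finite, 'c::finite, 'e::finite, 'u::finite, 'y::finite, 'p::finite, 'r::finite) loop
    \<Rightarrow> real^('n + 'c + 'e)^'p"
  where "C_p S = (mCJ S + mDJ S ** mDc S ** mC S) <|> (mDJ S ** mCc S) <|> 0"

definition D_p :: "real^'a^'u \<Rightarrow> real^'a^'y
    \<Rightarrow> ('n::finite, 'c::finite, 'e::finite, 'u::finite, 'y::finite, 'p::finite, 'r::finite) loop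
    \<Rightarrow> real^'a^'p"
  where "D_p Ba Da S = mDJ S ** (mDc S ** Da + Ba)"

definition C_r :: "('n::finite, 'c::finite, 'e::finite, 'u::finite, 'y::finite, 'p::finite, 'r::finite) loop
    \<Rightarrow> real^('n + 'c + 'e)^'r"
  where "C_r S = ((mDe S ** mDc S + mEe S) ** mC S) <|> (mDe S ** mCc S) <|> mCe S"

definition D_r :: "real^'a^'u \<Rightarrow> real^'a^'y
    \<Rightarrow> ('n::finite, 'c::finite, 'e::finite, 'u::finite, 'y::finite, 'p::finite, 'r::finite) loop
    \<Rightarrow> real^'a^'r"
  where "D_r Ba Da S = (mDe S ** mDc S + mEe S) ** Da"

definition closed_loop_x :: "real^'a^'u \<Rightarrow> real^'a^'y
    \<Rightarrow> ('n::finite, 'c::finite, 'e::finite, 'u::finite, 'y::finite, 'p::finite, 'r::finite) loop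
    \<Rightarrow> (nat \<Rightarrow> real^'a) \<Rightarrow> nat \<Rightarrow> real^('n + 'c + 'e)"
  where "closed_loop_x Ba Da S = state_traj (A_cl S) (B_cl Ba Da S)"

definition closed_loop_yp :: "real^'a^'u \<Rightarrow> real^'a^'y
    \<Rightarrow> ('n::finite, 'c::finite, 'e::finite, 'u::finite, 'y::finite, 'p::finite, 'r::finite) loop
    \<Rightarrow> (nat \<Rightarrow> real^'a) \<Rightarrow> nat \<Rightarrow> real^'p"
  where "closed_loop_yp Ba Da S = output_traj (A_cl S) (B_cl Ba Da S) (C_p S) (D_p Ba Da S)"

definition closed_loop_yr :: "real^'a^'u \<Rightarrow> real^'a^'y
    \<Rightarrow> ('n::finite, 'c::finite, 'e::finite, 'u::finite, 'y::finite, 'p::finite, 'r::finite) loop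
    \<Rightarrow> (nat \<Rightarrow> real^'a) \<Rightarrow> nat \<Rightarrow> real^'r"
  where "closed_loop_yr Ba Da S = output_traj (A_cl S) (B_cl Ba Da S) (C_r S) (D_r Ba Da S)"


section \<open>The two optimization problems\<close>

text \<open>Below, \<open>S \<delta>\<close> is the (perturbed) loop at the uncertainty \<open>\<delta>\<close>, and the samples form a family
  \<open>ds\<close> over a finite index type \<open>'N\<close>, so that \<open>CARD('N)\<close> is the number of samples, repetitions
  included.\<close>

definition stealthy_attacks :: "real^'a^'u \<Rightarrow> real^'a^'y
    \<Rightarrow> (real^'v \<Rightarrow> ('n::finite, 'c::finite, 'e::finite, 'u::finite, 'y::finite, 'p::finite, 'r::finite) loop)
    \<Rightarrow> (real^'v) set \<Rightarrow> (nat \<Rightarrow> real^'a) set"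
  where "stealthy_attacks Ba Da S W =
    {a \<in> l2e. \<forall>d\<in>W. l2_norm_sq (closed_loop_yr Ba Da (S d) a) \<le> 1 \<and>
                       closed_loop_x Ba Da (S d) a \<longlonglongrightarrow> 0}"

definition gamma_RA :: "real^'a^'u \<Rightarrow> real^'a^'y
    \<Rightarrow> (real^'v \<Rightarrow> ('n::finite, 'c::finite, 'e::finite, 'u::finite, 'y::finite, 'p::finite, 'r::finite) loop)
    \<Rightarrow> ('N::finite \<Rightarrow> real^'v) \<Rightarrow> ereal"
  where "gamma_RA Ba Da S ds =
    (SUP a \<in> stealthy_attacks Ba Da S (range ds).
       ereal (1 / real CARD('N)) * (\<Sum>i\<in>UNIV. l2_norm_sq (closed_loop_yp Ba Da (S (ds i)) a)))"

definition Psi :: "real^('N::finite \<times> 'x::finite)^('N \<times> 'p::finite) \<Rightarrow> real^'a^('N \<times> 'p)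
    \<Rightarrow> real^('N \<times> 'x)^('N \<times> 'r::finite) \<Rightarrow> real^'a^('N \<times> 'r)
    \<Rightarrow> real^'N \<Rightarrow> real^(('N \<times> 'x) + 'a)^(('N \<times> 'x) + 'a)"
  where "Psi Cp Dp Cr Dr g =
    (1 / real CARD('N)) *\<^sub>R ((transpose Cp <#> transpose Dp) ** (Cp <|> Dp))
    - (transpose Cr <#> transpose Dr) ** kron (diag g) (mat 1 :: real^'r^'r) ** (Cr <|> Dr)"

definition lmi_matrix :: "real^'X^'X \<Rightarrow> real^'a^'X \<Rightarrow> real^'X^'X \<Rightarrow> real^('X::finite + 'a::finite)^('X + 'a)"
  where "lmi_matrix A B P =
    ((transpose A ** P ** A - P) <|> (transpose A ** P ** B)) <#>
    ((transpose B ** P ** A)     <|> (transpose B ** P ** B))"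

definition sdp_feasible :: "real^'a^'u \<Rightarrow> real^'a^'y
    \<Rightarrow> (real^'v \<Rightarrow> ('n::finite, 'c::finite, 'e::finite, 'u::finite, 'y::finite, 'p::finite, 'r::finite) loop)
    \<Rightarrow> ('N::finite \<Rightarrow> real^'v)
    \<Rightarrow> ((real^'N) \<times> (real^('N \<times> ('n + 'c + 'e))^('N \<times> ('n + 'c + 'e)))) set"
  where "sdp_feasible Ba Da S ds =
    {(g, P). (\<forall>i. 0 \<le> g $ i) \<and> transpose P = P \<and>
       neg_semidef
         (lmi_matrix (blkdiag (\<lambda>i. A_cl (S (ds i)))) (vstack (\<lambda>i. B_cl Ba Da (S (ds i)))) P
          + Psi (blkdiag (\<lambda>i. C_p (S (ds i)))) (vstack (\<lambda>i. D_p Ba Da (S (ds i))))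
                (blkdiag (\<lambda>i. C_r (S (ds i)))) (vstack (\<lambda>i. D_r Ba Da (S (ds i)))) g)}"

end

theory Submission
  imports Defs
begin

text \<open>
  Weak duality is a telescoping argument: along a trajectory from \<open>0\<close> to \<open>0\<close> the storage
  \<open>x\<^sup>T P x\<close> contributes nothing to the summed dissipation inequality.

  For the converse it suffices to use attacks of finite support. The energies of the outputs are
  quadratic in the attack, and delaying one attack long enough makes it asymptotically orthogonal to
  another one; hence the closure of the set of attainable energy vectors is a convex cone, and separating
  it from the box of better values gives multipliers \<open>g\<close> with \<open>1 \<bullet> g \<le> \<gamma>\<^sub>R\<^sub>A\<close>. The stacked
  system need not be controllable, so these multipliers need not admit a storage matrix. After
  inflating \<open>g\<close> by \<open>(1 + h)\<^sup>2\<close> with \<open>h > 0\<close>, however, the available storage from any initial state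
  is bounded by a multiple of \<open>norm x ^ 2\<close> (here stability enters). A supremum of jointly quadratic
  functionals that is bounded in this way satisfies the parallelogram law, so it is a quadratic form
  \<open>x\<^sup>T P x\<close>, and \<open>P\<close> solves the matrix inequality. Since the theorem is about the infimum, \<open>h\<close>
  can tend to \<open>0\<close>.
\<close>

section \<open>Quadratic forms, multipliers and stable orbits\<close>

text \<open>Convergence on the finitely many basis vectors already makes some power of
  \<open>A\<close> a contraction by one half. Pointwise attractivity thus becomes geometric decay
  over blocks of fixed length, and the constant does not depend on \<open>x\<close>.\<close>

lemma stable_orbit_sum_bound:
  fixes A :: "real^'x^'x"
  assumes "\<And>x. (\<lambda>k. ((*v) A ^^ k) x) \<longlonglongrightarrow> 0"
  obtains L where "L \<ge> 0" "\<And>n x. (\<Sum>k<n. norm (((*v) A ^^ k) x)) \<le> L * norm x"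
proof -
  let ?P = "\<lambda>k. ((*v) A ^^ k)"
  have lin: "linear (?P k)" for k
    by (induction k) (auto simp: linear_compose[unfolded o_def] linear_id[unfolded id_def] o_def
      intro!: linear_compose[unfolded o_def])
  \<comment> \<open>Expanding a vector in the basis adds \<open>DIM\<close> terms of size at most
    \<open>norm x * c\<close>, which must total \<open>norm x / 2\<close>.\<close>
  define c where "c = 1 / (2 * real DIM(real^'x))"
  have c: "c > 0" by (simp add: c_def)
  have "\<forall>\<^sub>F k in sequentially. \<forall>b\<in>(Basis::(real^'x) set). norm (?P k b) < c"
    by (intro eventually_ball_finite finite_Basis ballI)
       (use order_tendstoD(2)[OF tendsto_norm_zero[OF assms] c] in auto)
  \<comment> \<open>Positivity of the exponent makes the remaining sum strictly shorter in the
    induction below.\<close>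
  then have "\<forall>\<^sub>F k in sequentially. 0 < k \<and> (\<forall>b\<in>(Basis::(real^'x) set). norm (?P k b) < c)"
    using eventually_gt_at_top[of 0] by (rule eventually_elim2) simp
  then obtain K where K0: "0 < K" and K: "\<And>b. b \<in> (Basis::(real^'x) set) \<Longrightarrow> norm (?P K b) < c"
    by (auto simp: eventually_sequentially)
  have half: "norm (?P K x) \<le> norm x / 2" for x
  proof -
    have "?P K x = (\<Sum>b\<in>Basis. (x \<bullet> b) *\<^sub>R ?P K b)"
      by (subst (1) euclidean_representation[symmetric, of x])
         (simp only: linear_sum[OF lin] linear_scale[OF lin])
    also have "norm \<dots> \<le> (\<Sum>b\<in>(Basis::(real^'x) set). norm x * c)"
      by (intro sum_norm_le) (auto intro!: mult_mono Basis_le_norm less_imp_le[OF K])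
    also have "\<dots> = norm x / 2" by (simp add: c_def)
    finally show ?thesis .
  qed
  obtain m where m: "\<And>k x. norm (?P k x) \<le> m k * norm x"
  proof -
    have "\<exists>b. \<forall>x. norm (?P k x) \<le> b * norm x" for k
      using linear_bounded[OF lin] by blast
    then show ?thesis using that by metis
  qed
  define M where "M = (\<Sum>k<K. \<bar>m k\<bar>)"
  have M0: "M \<ge> 0" by (simp add: M_def sum_nonneg)
  have short: "(\<Sum>k<n. norm (?P k x)) \<le> M * norm x" if "n \<le> K" for n x
  proof -
    have "(\<Sum>k<n. norm (?P k x)) \<le> (\<Sum>k<K. norm (?P k x))"
      using that by (intro sum_mono2) auto
    also have "\<dots> \<le> (\<Sum>k<K. \<bar>m k\<bar> * norm x)"
      by (intro sum_mono order_trans[OF m] mult_right_mono) auto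
    finally show ?thesis by (simp only: M_def sum_distrib_right)
  qed
  text \<open>As \<open>A ^ K\<close> halves norms, splitting off the first \<open>K\<close> terms turns a bound \<open>2 * M\<close> for
    shorter sums into \<open>M + 2 * M / 2 = 2 * M\<close>.\<close>
  have "(\<Sum>k<n. norm (?P k x)) \<le> 2 * M * norm x" for n x
  proof (induction n arbitrary: x rule: less_induct)
    case (less n)
    show ?case
    proof (cases "n \<le> K")
      case True
      have "M * norm x \<ge> 0" using M0 by simp
      then show ?thesis using short[OF True, of x] by linarith
    next
      case False
      then obtain j where n: "n = j + K" and j: "j < n"
        using K0 by (metis add.commute le_add_diff_inverse nat_le_linear less_add_same_cancel1)
      have "(\<Sum>k<n. norm (?P k x)) = (\<Sum>k<K. norm (?P k x)) + (\<Sum>k<j. norm (?P (k + K) x))"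
        using sum.atLeastLessThan_concat[of 0 K "j + K" "\<lambda>k. norm (?P k x)"]
          sum.shift_bounds_nat_ivl[of "\<lambda>k. norm (?P k x)" 0 K j]
        by (simp add: n lessThan_atLeast0)
      also have "\<dots> \<le> M * norm x + 2 * M * norm (?P K x)"
        using short[of K x] less.IH[OF j, of "?P K x"] by (simp add: funpow_add)
      also have "\<dots> \<le> M * norm x + 2 * M * (norm x / 2)"
        using M0 half[of x] by (intro add_left_mono mult_left_mono) auto
      finally show ?thesis by simp
    qed
  qed
  then show ?thesis using that[of "2 * M"] M0 by simp
qed

text \<open>This is the Jordan-von Neumann argument: polarization yields a symmetric biadditive map,
  and the quadratic bound takes the place of continuity in passing to real homogeneity.\<close>

lemma parallelogram_imp_quadratic_form:
  fixes V :: "real^'x \<Rightarrow> real"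
  assumes par: "\<And>x y. V (x + y) + V (x - y) = 2 * V x + 2 * V y"
    and bound: "\<And>x. \<bar>V x\<bar> \<le> c * (norm x)\<^sup>2"
  obtains P where "transpose P = P" "\<And>x. V x = x \<bullet> (P *v x)"
proof -
  define b where "b x y = (V (x + y) - V (x - y)) / 4" for x y
  have V0: "V 0 = 0" using par[of 0 0] by simp
  have Vm: "V (- x) = V x" for x using par[of 0 x] V0 by simp
  have b_sym: "b x y = b y x" for x y
    using Vm[of "x - y"] by (simp add: b_def add.commute)
  have b_diag: "b x x = V x" for x
    using par[of x x] by (simp add: b_def V0)
  have b_0: "b 0 y = 0" for y by (simp add: b_def Vm)
  have b_add2: "b (x + z) y + b (x - z) y = 2 * b x y" for x y z
  proof -
    have e: "x + y + z = x + z + y" "x + y - z = x - z + y" "x - y + z = x + z - y" "x - y - z = x - z - y"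
      by simp_all
    \<comment> \<open>Subtract the parallelogram laws for \<open>x + y\<close> and
      \<open>x - y\<close>, both with increment \<open>z\<close>.\<close>
    show ?thesis
      using par[of "x + y" z] par[of "x - y" z] unfolding e b_def by (simp add: field_simps)
  qed
  have b_double: "b (x + x) y = 2 * b x y" for x y
    using b_add2[of x x y] by (simp add: b_0)
  have b_add: "b (x + z) y = b x y + b z y" for x y z
  proof -
    \<comment> \<open>With half-sum and half-difference, \<open>b_add2\<close> has
      \<open>b x y + b z y\<close> on one side and, by \<open>b_double\<close>,
      \<open>b (x + z) y\<close> on the other.\<close>
    let ?u = "(1/2) *\<^sub>R (x + z)" and ?v = "(1/2) *\<^sub>R (x - z)"
    have e: "?u + ?u = x + z" "?u + ?v = x" "?u - ?v = z"
      by (vector field_simps)+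
    show ?thesis using b_add2[of ?u ?v y] b_double[of ?u y] by (simp only: e)
  qed
  have c0: "c \<ge> 0" 
    using bound[of "axis undefined 1"] by (smt (verit) mult_nonneg_nonneg norm_axis_1 mult_cancel_left1 one_power2)
  have b_bound: "\<bar>b x y\<bar> \<le> c * ((norm x)\<^sup>2 + (norm y)\<^sup>2)" for x y
  proof -
    have "\<bar>b x y\<bar> \<le> (c * (norm (x + y))\<^sup>2 + c * (norm (x - y))\<^sup>2) / 4"
      using bound[of "x + y"] bound[of "x - y"] by (simp add: b_def)
    also have "\<dots> = c * ((norm x)\<^sup>2 + (norm y)\<^sup>2) / 2"
      by (simp add: power2_norm_eq_inner inner_simps algebra_simps inner_commute)
    also have "\<dots> \<le> c * ((norm x)\<^sup>2 + (norm y)\<^sup>2)" using c0 by simp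
    finally show ?thesis .
  qed
  have b_scale: "b (t *\<^sub>R x) y = t * b x y" for t x y
  proof -
    text \<open>The deviation from homogeneity is additive in \<open>t\<close>, vanishes on the integers and is
      bounded on the unit interval, hence bounded, hence zero.\<close>
    define h where "h t = b (t *\<^sub>R x) y - t * b x y" for t
    have h_add: "h (s + t) = h s + h t" for s t
      by (simp add: h_def b_add scaleR_add_left algebra_simps)
    have h_nat: "h (real n * t) = real n * h t" for n t
    proof (induction n)
      case 0 show ?case by (simp add: h_def b_0)
    next
      case (Suc n)
      then show ?case using h_add[of t "real n * t"] by (simp add: algebra_simps)
    qed
    have h0: "h 0 = 0" by (simp add: h_def b_0)
    have h1: "h 1 = 0" by (simp add: h_def)
    have h_minus: "h (- t) = - h t" for t using h_add[of t "- t"] h0 by simp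
    have h_int: "h (of_int n) = 0" for n
      using h_nat[of _ 1] h1 h_minus by (cases n rule: int_cases2) auto
    define K where "K = c * ((norm x)\<^sup>2 + (norm y)\<^sup>2) + \<bar>b x y\<bar>"
    have hK: "\<bar>h t\<bar> \<le> K" for t
    proof -
      have "h t = h (frac t)" using h_add[of "frac t" "of_int \<lfloor>t\<rfloor>"] h_int by (simp add: frac_def)
      also have "\<bar>\<dots>\<bar> \<le> \<bar>b (frac t *\<^sub>R x) y\<bar> + \<bar>frac t\<bar> * \<bar>b x y\<bar>"
        unfolding h_def by (metis abs_mult abs_triangle_ineq4)
      also have "\<dots> \<le> c * ((norm (frac t *\<^sub>R x))\<^sup>2 + (norm y)\<^sup>2) + 1 * \<bar>b x y\<bar>"
        using frac_lt_1[of t] frac_ge_0[of t] by (intro add_mono b_bound mult_right_mono) auto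
      also have "\<dots> \<le> K" unfolding K_def
        using frac_lt_1[of t] frac_ge_0[of t] c0
        by (auto intro!: mult_left_mono mult_left_le_one_le power_le_one
             simp: power_mult_distrib)
      finally show ?thesis .
    qed
    have "h t = 0"
    proof (rule ccontr)
      assume "h t \<noteq> 0"
      then obtain n where "K < real n * \<bar>h t\<bar>" using reals_Archimedean3[of "\<bar>h t\<bar>"] by auto
      with hK[of "real n * t"] show False by (simp add: h_nat abs_mult)
    qed
    then show ?thesis by (simp add: h_def)
  qed
  \<comment> \<open>The Gram matrix of the polarized form in the standard basis.\<close>
  define P where "P = (\<chi> i j. b (axis i 1) (axis j 1))"
  have b_sum1: "b (\<Sum>i\<in>I. f i *\<^sub>R g i) y = (\<Sum>i\<in>I. f i * b (g i) y)" if "finite I"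
    for I :: "'x set" and f g y
    using that by induction (auto simp: b_0 b_add b_scale)
  have ex: "x = (\<Sum>i\<in>UNIV. x $ i *\<^sub>R axis i 1)" for x :: "real^'x"
    using basis_expansion[of x] by (simp add: scalar_mult_eq_scaleR)
  have bP: "b x y = x \<bullet> (P *v y)" for x y
  proof -
    have b_expand: "b x y = (\<Sum>i\<in>UNIV. x $ i * b (axis i 1) y)" for x y
      by (subst (1) ex) (simp add: b_sum1)
    have "b x y = (\<Sum>i\<in>UNIV. x $ i * (\<Sum>j\<in>UNIV. y $ j * b (axis j 1) (axis i 1)))"
      unfolding b_expand[of x y] b_sym[of "axis _ 1" y] b_expand[of y "axis _ 1"] ..
    also have "\<dots> = x \<bullet> (P *v y)"
      by (simp add: inner_vec_def matrix_vector_mult_def P_def mult.commute b_sym)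
    finally show ?thesis .
  qed
  show ?thesis
  proof (rule that)
    show "transpose P = P" by (simp add: P_def transpose_def vec_eq_iff b_sym)
    show "V x = x \<bullet> (P *v x)" for x by (simp add: bP[symmetric] b_diag)
  qed
qed

text \<open>The set \<open>S\<close> need not be convex, but its closure is a convex cone because
  sums stay in the closure. A hyperplane separating it from the open set of better values has as its
  normalized coefficients the Lagrange multipliers.\<close>

lemma lossless_s_procedure:
  fixes S :: "(real \<times> (real^'N)) set"
  assumes "0 \<in> S"
    and scale: "\<And>t s. t \<ge> 0 \<Longrightarrow> s \<in> S \<Longrightarrow> t *\<^sub>R s \<in> S"
    and add: "\<And>s t. s \<in> S \<Longrightarrow> t \<in> S \<Longrightarrow> s + t \<in> closure S"
    and b: "\<And>s. s \<in> S \<Longrightarrow> (\<And>i. snd s $ i \<le> 1) \<Longrightarrow> fst s \<le> b"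
  obtains g where "\<And>i. 0 \<le> g $ i" "(1 :: real^'N) \<bullet> g \<le> b" "\<And>s. s \<in> S \<Longrightarrow> fst s \<le> g \<bullet> snd s"
proof -
  have cl_scale: "t *\<^sub>R s \<in> closure S" if t: "t \<ge> 0" and s: "s \<in> closure S" for t s
  proof -
    obtain f where f: "\<And>n. f n \<in> S" "f \<longlonglongrightarrow> s" using s by (auto simp: closure_sequential)
    have "(\<lambda>n. t *\<^sub>R f n) \<longlonglongrightarrow> t *\<^sub>R s" by (intro tendsto_intros f)
    then show ?thesis using scale[OF t f(1)]
      unfolding closure_sequential by (intro exI[of _ "\<lambda>n. t *\<^sub>R f n"]) simp
  qed
  have cl_add: "s + t \<in> closure S" if s: "s \<in> closure S" and t: "t \<in> closure S" for s t
  proof -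
    obtain f where f: "\<And>n. f n \<in> S" "f \<longlonglongrightarrow> s" using s by (auto simp: closure_sequential)
    obtain g where g: "\<And>n. g n \<in> S" "g \<longlonglongrightarrow> t" using t by (auto simp: closure_sequential)
    have "(\<lambda>n. f n + g n) \<longlonglongrightarrow> s + t" by (intro tendsto_intros f g)
    then show ?thesis
      by (rule closed_sequentially[OF closed_closure add[OF f(1) g(1)]])
  qed
  have conv: "convex (closure S)"
    unfolding convex_def by (auto intro!: cl_add cl_scale)
  \<comment> \<open>Objective above \<open>b\<close> with all constraints strict. Being open,
    \<open>T\<close> misses \<open>closure S\<close> as soon as it misses \<open>S\<close>.\<close>
  define T where "T = {b<..} \<times> {s :: real^'N. \<forall>i. s $ i < 1}"
  have box: "{s :: real^'N. \<forall>i. s $ i < 1} = (\<Inter>i. {s. s $ i < 1})" by auto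
  have "convex T" unfolding T_def box
    by (intro convex_Times convex_INT convex_real_interval)
       (auto simp: convex_def intro!: convex_bound_lt)
  moreover have "open T" unfolding T_def box
    by (intro open_Times open_INT ballI open_halfspace_component_lt_cart) auto
  moreover have "T \<inter> S = {}" unfolding T_def using b by (force dest: less_imp_le)
  moreover have T0: "(b + t, (\<chi> i. 1 - f i)) \<in> T" if "t > 0" "\<And>i. f i > 0" for t f
    using that by (simp add: T_def)
  ultimately have "\<exists>a d. a \<noteq> 0 \<and> (\<forall>s\<in>closure S. a \<bullet> s \<le> d) \<and> (\<forall>s\<in>T. a \<bullet> s \<ge> d)"
    using separating_hyperplane_sets[OF conv, of T] \<open>0 \<in> S\<close> closure_subset[of S]
      open_Int_closure_eq_empty[of T S] T0[of 1 "\<lambda>_. 1"]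
    by (auto simp: Int_commute)
  then obtain a d where a: "a \<noteq> 0" and aS: "\<And>s. s \<in> S \<Longrightarrow> a \<bullet> s \<le> d"
    and aT: "\<And>s. s \<in> T \<Longrightarrow> a \<bullet> s \<ge> d"
    using closure_subset[of S] by blast
  obtain a0 a1 where aa: "a = (a0, a1)" by force
  have d0: "d \<ge> 0" using aS[OF \<open>0 \<in> S\<close>] by simp
  \<comment> \<open>A linear functional bounded above on a cone cannot be positive anywhere on
    it.\<close>
  have aS0: "a \<bullet> s \<le> 0" if "s \<in> S" for s
  proof (rule ccontr)
    assume "\<not> a \<bullet> s \<le> 0"
    then obtain n where "d < real n * (a \<bullet> s)" using reals_Archimedean3[of "a \<bullet> s"] by auto
    with aS[OF scale[of "real n", OF _ that]] show False by simp
  qed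
  have aT0: "a0 * (b + t) + (\<Sum>i\<in>UNIV. a1 $ i * (1 - f i)) \<ge> 0" if "t > 0" "\<And>i. f i > 0" for t f
    using order_trans[OF d0 aT[OF T0[of t f, OF that]]] by (simp add: aa inner_vec_def)
  \<comment> \<open>The set \<open>T\<close> is unbounded upwards in the objective and downwards in
    every constraint; moving along these directions fixes the signs of \<open>a0\<close> and
    \<open>a1\<close>.\<close>
  have a0: "a0 \<ge> 0"
  proof (rule ccontr)
    assume neg: "\<not> a0 \<ge> 0"
    then obtain n where n: "\<bar>a0 * b\<bar> < real n * (- a0)"
      using reals_Archimedean3[of "- a0"] by auto
    then have "0 < n" by (cases n) auto
    with n aT0[of "real n" "\<lambda>_. 1"] show False by (simp add: algebra_simps)
  qed
  have a1: "a1 $ i \<le> 0" for i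
  proof (rule ccontr)
    assume pos: "\<not> a1 $ i \<le> 0"
    then obtain n where n: "\<bar>a0 * (b + 1)\<bar> < real n * (a1 $ i)"
      using reals_Archimedean3[of "a1 $ i"] by auto
    have "(\<Sum>j\<in>UNIV. a1 $ j * (1 - (if j = i then 1 + real n else 1)))
       = (\<Sum>j\<in>UNIV. if j = i then - real n * a1 $ i else 0)" by (rule sum.cong) auto
    moreover have "0 < (if j = i then 1 + real n else 1)" for j by simp
    ultimately show False
      using n aT0[of 1 "\<lambda>j. if j = i then 1 + real n else 1"] by simp
  qed
  \<comment> \<open>The corner \<open>(b, 1)\<close> of \<open>T\<close> is reached only in the
    limit; its inequality will bound the sum of the multipliers.\<close>
  have lim: "a0 * b + (\<Sum>i\<in>UNIV. a1 $ i) \<ge> 0"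
  proof -
    have "((\<lambda>t. a0 * (b + t) + (\<Sum>i\<in>UNIV. a1 $ i * (1 - t))) \<longlongrightarrow>
          a0 * (b + 0) + (\<Sum>i\<in>UNIV. a1 $ i * (1 - 0))) (at_right 0)"
      by (intro tendsto_intros)
    moreover have "\<forall>\<^sub>F t in at_right 0. a0 * (b + t) + (\<Sum>i\<in>UNIV. a1 $ i * (1 - t)) \<ge> 0"
      using aT0[of _ "\<lambda>_. _"] by (auto simp: eventually_at_right_field intro!: exI[of _ 1])
    ultimately show ?thesis by (auto dest: tendsto_lowerbound)
  qed
  \<comment> \<open>The hyperplane is not vertical: with \<open>a0 = 0\<close> the corner inequality
    and the signs of \<open>a1\<close> would force \<open>a = 0\<close>.\<close>
  have "a0 \<noteq> 0"
  proof
    assume z: "a0 = 0"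
    have "(\<Sum>i\<in>UNIV. - a1 $ i) = 0"
      using lim z a1 sum_nonneg[of UNIV "\<lambda>i. - a1 $ i"] by (simp add: sum_negf)
    then have "\<forall>i. a1 $ i = 0"
      using a1 by (subst (asm) sum_nonneg_eq_0_iff) auto
    then show False using z a aa by (simp add: vec_eq_iff zero_prod_def)
  qed
  then have pos: "a0 > 0" using a0 by simp
  show ?thesis
  proof (rule that[of "- (1 / a0) *\<^sub>R a1"])
    show "0 \<le> (- (1 / a0) *\<^sub>R a1) $ i" for i
      using a1[of i] pos by (simp add: divide_nonpos_pos)
    have "(1 :: real^'N) \<bullet> a1 = (\<Sum>i\<in>UNIV. a1 $ i)" by (simp add: inner_vec_def)
    then show "1 \<bullet> (- (1 / a0) *\<^sub>R a1) \<le> b" using lim pos by (simp add: field_simps)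
    show "fst s \<le> (- (1 / a0) *\<^sub>R a1) \<bullet> snd s" if "s \<in> S" for s
      using aS0[OF that] pos by (simp add: aa inner_prod_def field_simps)
  qed
qed

section \<open>Finite signals and output energies\<close>

lemma suminf_linear_combination:
  fixes f g :: "nat \<Rightarrow> real"
  assumes "summable f" "summable g"
  shows "(\<Sum>k. a * f k + b * g k) = a * (\<Sum>k. f k) + b * (\<Sum>k. g k)"
  using suminf_add[of "\<lambda>k. a * f k" "\<lambda>k. b * g k"] assms
  by (simp add: summable_mult suminf_mult)

text \<open>The initial state is a parameter because the storage function is a supremum over attacks
  started at an arbitrary state.\<close>

primrec traj :: "real^'x^'x \<Rightarrow> real^'u^'x \<Rightarrow> real^'x \<Rightarrow> (nat \<Rightarrow> real^'u) \<Rightarrow> nat \<Rightarrow> real^'x" where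
  "traj A B x u 0 = x"
| "traj A B x u (Suc k) = A *v traj A B x u k + B *v u k"

definition outp :: "real^'x^'x \<Rightarrow> real^'u^'x \<Rightarrow> real^'x^'y \<Rightarrow> real^'u^'y
    \<Rightarrow> real^'x \<Rightarrow> (nat \<Rightarrow> real^'u) \<Rightarrow> nat \<Rightarrow> real^'y"
  where "outp A B C D x u k = C *v traj A B x u k + D *v u k"

text \<open>A real series, hence the total energy only when it converges;
  \<open>summable_energy\<close> ensures this for finite signals.\<close>

definition energy :: "real^'x^'x \<Rightarrow> real^'u^'x \<Rightarrow> real^'x^'y \<Rightarrow> real^'u^'y
    \<Rightarrow> real^'x \<Rightarrow> (nat \<Rightarrow> real^'u) \<Rightarrow> real"
  where "energy A B C D x u = (\<Sum>k. (norm (outp A B C D x u k))\<^sup>2)"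

definition finite_signals :: "(nat \<Rightarrow> real^'u) set"
  where "finite_signals = {u. \<forall>\<^sub>F k in sequentially. u k = 0}"

definition delay :: "nat \<Rightarrow> (nat \<Rightarrow> real^'u) \<Rightarrow> nat \<Rightarrow> real^'u"
  where "delay n u k = (if k < n then 0 else u (k - n))"

section \<open>Linearity and time invariance of trajectories\<close>

lemma traj_add: "traj A B (x + y) (\<lambda>k. u k + v k) k = traj A B x u k + traj A B y v k"
  by (induction k) (simp_all add: matrix_vector_right_distrib algebra_simps)

lemma traj_scaleR: "traj A B (t *\<^sub>R x) (\<lambda>k. t *\<^sub>R u k) k = t *\<^sub>R traj A B x u k"
  by (induction k) (simp_all add: matrix_vector_mult_scaleR algebra_simps)

lemma outp_add: "outp A B C D (x + y) (\<lambda>k. u k + v k) k = outp A B C D x u k + outp A B C D y v k"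
  by (simp add: outp_def traj_add matrix_vector_right_distrib)

lemma outp_scaleR: "outp A B C D (t *\<^sub>R x) (\<lambda>k. t *\<^sub>R u k) k = t *\<^sub>R outp A B C D x u k"
  by (simp add: outp_def traj_scaleR matrix_vector_mult_scaleR algebra_simps)

lemma outp_diff: "outp A B C D (x - y) (\<lambda>k. u k - v k) k = outp A B C D x u k - outp A B C D y v k"
  using outp_add[of A B C D x "- y" u "\<lambda>k. - v k" k] outp_scaleR[of A B C D "- 1" y v k] by simp

text \<open>The signal \<open>case_nat w u\<close> plays \<open>w\<close> first and then
  \<open>u\<close>, so after one step the system restarts from the successor state. This is the
  basis of the dynamic programming step.\<close>

lemma traj_case_nat: "traj A B x (case_nat w u) (Suc k) = traj A B (A *v x + B *v w) u k"
  by (induction k) simp_all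

lemma outp_case_nat: "outp A B C D x (case_nat w u) (Suc k) = outp A B C D (A *v x + B *v w) u k"
  by (simp add: outp_def traj_case_nat del: traj.simps)

text \<open>A system at rest stays at rest until the delayed signal begins; this is where the zero
  initial state matters.\<close>

lemma traj_delay: "traj A B 0 (delay n u) k = (if k < n then 0 else traj A B 0 u (k - n))"
proof (induction k)
  case (Suc k)
  then show ?case
    by (cases "k < n"; cases "Suc k < n") (auto simp: delay_def Suc_diff_le not_less less_Suc_eq le_less)
qed simp

lemma outp_delay: "outp A B C D 0 (delay n u) k = (if k < n then 0 else outp A B C D 0 u (k - n))"
  by (simp add: outp_def traj_delay) (simp add: delay_def)

lemma finite_signals_zero: "(\<lambda>_. 0) \<in> finite_signals"
  by (simp add: finite_signals_def)

lemma finite_signals_add: "u \<in> finite_signals \<Longrightarrow> v \<in> finite_signals \<Longrightarrow> (\<lambda>k. u k + v k) \<in> finite_signals"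
  by (auto simp: finite_signals_def elim: eventually_elim2)

lemma finite_signals_diff: "u \<in> finite_signals \<Longrightarrow> v \<in> finite_signals \<Longrightarrow> (\<lambda>k. u k - v k) \<in> finite_signals"
  by (auto simp: finite_signals_def elim: eventually_elim2)

lemma finite_signals_scaleR: "u \<in> finite_signals \<Longrightarrow> (\<lambda>k. t *\<^sub>R u k) \<in> finite_signals"
  by (auto simp: finite_signals_def elim: eventually_mono)

lemma finite_signals_delay: "u \<in> finite_signals \<Longrightarrow> delay n u \<in> finite_signals"
  unfolding finite_signals_def delay_def
  using eventually_sequentially_seg[of "\<lambda>k. (if k < n then 0 else u (k - n)) = 0" n] by simp

lemma finite_signals_case_nat: "u \<in> finite_signals \<Longrightarrow> case_nat w u \<in> finite_signals"
  unfolding finite_signals_def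
  using eventually_sequentially_Suc[of "\<lambda>k. case_nat w u k = 0"] by simp

section \<open>Output energies when the origin is attractive\<close>

locale attractive_system =
  fixes A :: "real^'x^'x" and B :: "real^'u^'x"
  assumes attractive: "(\<lambda>k. ((*v) A ^^ k) x) \<longlonglongrightarrow> 0"
begin

lemma summable_free:
  obtains L where "L \<ge> 0" "\<And>x. summable (\<lambda>k. norm (((*v) A ^^ k) x))"
    "\<And>x. (\<Sum>k. norm (((*v) A ^^ k) x)) \<le> L * norm x"
proof -
  obtain L where L: "L \<ge> 0" "\<And>n x. (\<Sum>k<n. norm (((*v) A ^^ k) x)) \<le> L * norm x"
    using stable_orbit_sum_bound[of A] attractive by blast
  have "summable (\<lambda>k. norm (((*v) A ^^ k) x))" for x
    by (rule summableI_nonneg_bounded[OF _ L(2)]) simp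
  then show ?thesis using that[OF L(1)] suminf_le_const[OF _ L(2)] by blast
qed

lemma traj_free: "(\<And>k. u (n + k) = 0) \<Longrightarrow> traj A B x u (n + k) = ((*v) A ^^ k) (traj A B x u n)"
  by (induction k) simp_all

text \<open>Once the support of \<open>u\<close> has passed, the trajectory is a free orbit.\<close>

lemma summable_norm_traj:
  assumes "u \<in> finite_signals"
  shows "summable (\<lambda>k. norm (traj A B x u k))"
proof -
  obtain n where "\<And>k. k \<ge> n \<Longrightarrow> u k = 0"
    using assms by (auto simp: finite_signals_def eventually_sequentially)
  then have n: "u (n + k) = 0" for k by simp
  obtain L where "\<And>x. summable (\<lambda>k. norm (((*v) A ^^ k) x))" using summable_free by blast
  then have "summable (\<lambda>k. norm (traj A B x u (k + n)))"
    using traj_free[of u n, OF n] by (simp add: add.commute)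
  then show ?thesis by (subst (asm) summable_iff_shift)
qed

lemma traj_tendsto_0: "u \<in> finite_signals \<Longrightarrow> traj A B x u \<longlonglongrightarrow> 0"
  using summable_LIMSEQ_zero[OF summable_norm_traj] by (simp add: tendsto_norm_zero_iff)

lemma summable_norm_outp:
  assumes u: "u \<in> finite_signals"
  shows "summable (\<lambda>k. norm (outp A B C D x u k))"
proof -
  obtain c where c: "\<And>z. norm (C *v z) \<le> c * norm z"
    using linear_bounded[OF matrix_vector_mul_linear[of C]] by blast
  obtain n where n: "\<And>k. k \<ge> n \<Longrightarrow> u k = 0"
    using u by (auto simp: finite_signals_def eventually_sequentially)
  show ?thesis
  proof (rule summable_comparison_test'[OF summable_mult[OF summable_norm_traj[OF u]]])
    show "norm (norm (outp A B C D x u k)) \<le> c * norm (traj A B x u k)" if "n \<le> k" for k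
      using c[of "traj A B x u k"] n[OF that] by (simp add: outp_def)
  qed
qed

lemma summable_energy:
  assumes u: "u \<in> finite_signals"
  shows "summable (\<lambda>k. (norm (outp A B C D x u k))\<^sup>2)"
proof -
  have "outp A B C D x u \<longlonglongrightarrow> 0"
    using summable_LIMSEQ_zero[OF summable_norm_outp[OF u]] by (simp add: tendsto_norm_zero_iff)
  then have "\<forall>\<^sub>F k in sequentially. norm (outp A B C D x u k) < 1"
    using order_tendstoD(2)[OF tendsto_norm_zero] by force
  \<comment> \<open>A number in the unit interval dominates its square, so the energies inherit
    summability from the norms.\<close>
  then have "\<forall>\<^sub>F k in sequentially. norm ((norm (outp A B C D x u k))\<^sup>2) \<le> norm (outp A B C D x u k)"
    by eventually_elim (simp add: power2_eq_square mult_left_le)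
  then show ?thesis by (rule summable_comparison_test_ev) (rule summable_norm_outp[OF u])
qed

lemma energy_nonneg: "u \<in> finite_signals \<Longrightarrow> energy A B C D x u \<ge> 0"
  unfolding energy_def by (intro suminf_nonneg summable_energy) auto

lemma energy_zero: "energy A B C D 0 (\<lambda>_. 0) = 0"
  using outp_scaleR[of A B C D 0 0 "\<lambda>_. 0"] by (simp add: energy_def)

lemma energy_scaleR:
  "u \<in> finite_signals \<Longrightarrow> energy A B C D (t *\<^sub>R x) (\<lambda>k. t *\<^sub>R u k) = t\<^sup>2 * energy A B C D x u"
  unfolding energy_def by (simp add: outp_scaleR power_mult_distrib suminf_mult summable_energy)

text \<open>Outputs are linear in the pair of initial state and signal, so the law holds sample by
  sample.\<close>

lemma energy_parallelogram:
  assumes "u \<in> finite_signals" "v \<in> finite_signals"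
  shows "energy A B C D (x + y) (\<lambda>k. u k + v k) + energy A B C D (x - y) (\<lambda>k. u k - v k)
    = 2 * energy A B C D x u + 2 * energy A B C D y v"
proof -
  have "energy A B C D (x + y) (\<lambda>k. u k + v k) + energy A B C D (x - y) (\<lambda>k. u k - v k)
    = (\<Sum>k. (norm (outp A B C D (x + y) (\<lambda>k. u k + v k) k))\<^sup>2
          + (norm (outp A B C D (x - y) (\<lambda>k. u k - v k) k))\<^sup>2)"
    unfolding energy_def
    by (intro suminf_add summable_energy finite_signals_add finite_signals_diff assms)
  also have "\<dots> = (\<Sum>k. 2 * (norm (outp A B C D x u k))\<^sup>2 + 2 * (norm (outp A B C D y v k))\<^sup>2)"
    by (simp add: outp_add outp_diff power2_norm_eq_inner inner_simps inner_commute algebra_simps)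
  also have "\<dots> = 2 * energy A B C D x u + 2 * energy A B C D y v"
    unfolding energy_def
    by (intro suminf_linear_combination summable_energy assms)
  finally show ?thesis .
qed

text \<open>Young's inequality in each sample. The factor on the first energy can be brought as
  close to \<open>1\<close> as desired, at the expense of the second.\<close>

lemma energy_add_le:
  assumes u: "u \<in> finite_signals" and v: "v \<in> finite_signals" and h: "h > 0"
  shows "energy A B C D (x + y) (\<lambda>k. u k + v k)
    \<le> (1 + h) * energy A B C D x u + (1 + 1 / h) * energy A B C D y v"
proof -
  have young: "(norm (a + b))\<^sup>2 \<le> (1 + h) * (norm a)\<^sup>2 + (1 + 1 / h) * (norm b)\<^sup>2" for a b :: "real^'y"
  proof -
    \<comment> \<open>Expanding this square bounds the cross term \<open>2 * (a \<bullet> b)\<close>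
      with exactly the required weights.\<close>
    have "0 \<le> (norm (h *\<^sub>R a - b))\<^sup>2 / h" using h by simp
    also have "(norm (h *\<^sub>R a - b))\<^sup>2 = h\<^sup>2 * (a \<bullet> a) - 2 * h * (a \<bullet> b) + b \<bullet> b"
      unfolding power2_norm_eq_inner
      by (simp add: inner_simps inner_commute power2_eq_square algebra_simps)
    also have "\<dots> / h = h * (a \<bullet> a) - 2 * (a \<bullet> b) + (1 / h) * (b \<bullet> b)"
      using h by (simp add: field_simps power2_eq_square)
    finally show ?thesis by (simp add: power2_norm_eq_inner inner_simps inner_commute algebra_simps)
  qed
  have "energy A B C D (x + y) (\<lambda>k. u k + v k)
    \<le> (\<Sum>k. (1 + h) * (norm (outp A B C D x u k))\<^sup>2 + (1 + 1 / h) * (norm (outp A B C D y v k))\<^sup>2)"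
    unfolding energy_def
    by (intro suminf_le summable_energy finite_signals_add summable_add summable_mult u v)
       (simp only: outp_add young)
  also have "\<dots> = (1 + h) * energy A B C D x u + (1 + 1 / h) * energy A B C D y v"
    unfolding energy_def
    by (intro suminf_linear_combination summable_energy u v)
  finally show ?thesis .
qed

lemma energy_step:
  assumes u: "u \<in> finite_signals"
  shows "energy A B C D x (case_nat w u)
    = (norm (C *v x + D *v w))\<^sup>2 + energy A B C D (A *v x + B *v w) u"
proof -
  have "outp A B C D x (case_nat w u) 0 = C *v x + D *v w" by (simp add: outp_def)
  then show ?thesis
    using suminf_split_head[OF summable_energy[OF finite_signals_case_nat[OF u]], of C D x w]
    unfolding energy_def outp_case_nat by simp
qed

text \<open>A sum of squares is at most the largest term times the sum of the terms, and both
  factors are at most \<open>L * norm x\<close> along a free orbit.\<close>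

lemma free_energy_bound:
  obtains c where "c \<ge> 0" "\<And>x. energy A B C D x (\<lambda>_. 0) \<le> c * (norm x)\<^sup>2"
proof -
  obtain L where L: "L \<ge> 0" and sm: "\<And>x. summable (\<lambda>k. norm (((*v) A ^^ k) x))"
    and le: "\<And>x. (\<Sum>k. norm (((*v) A ^^ k) x)) \<le> L * norm x" using summable_free by blast
  obtain c where c0: "c \<ge> 0" and c: "\<And>z. norm (C *v z) \<le> norm z * c"
    using bounded_linear.nonneg_bounded[OF matrix_vector_mul_bounded_linear[of C]] by blast
  have "energy A B C D x (\<lambda>_. 0) \<le> c\<^sup>2 * L\<^sup>2 * (norm x)\<^sup>2" for x
  proof -
    have o: "outp A B C D x (\<lambda>_. 0) k = C *v (((*v) A ^^ k) x)" for k
      using traj_free[of "\<lambda>_. 0" 0 x k] by (simp add: outp_def)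
    have le1: "norm (((*v) A ^^ k) x) \<le> L * norm x" for k
      by (rule order_trans[OF _ le[of x]])
         (use sum_le_suminf[OF sm, of "{k}" x] in simp)
    have "energy A B C D x (\<lambda>_. 0) \<le> (\<Sum>k. (c\<^sup>2 * (L * norm x)) * norm (((*v) A ^^ k) x))"
      unfolding energy_def
    proof (intro suminf_le summable_energy finite_signals_zero summable_mult sm)
      fix k
      have "(norm (C *v (((*v) A ^^ k) x)))\<^sup>2 \<le> (norm (((*v) A ^^ k) x) * c)\<^sup>2"
        by (intro power_mono c) simp
      also have "\<dots> = c\<^sup>2 * (norm (((*v) A ^^ k) x) * norm (((*v) A ^^ k) x))"
        by (simp add: power2_eq_square)
      also have "\<dots> \<le> c\<^sup>2 * (L * norm x * norm (((*v) A ^^ k) x))"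
        by (intro mult_left_mono mult_right_mono le1) auto
      finally show "(norm (outp A B C D x (\<lambda>_. 0) k))\<^sup>2 \<le> (c\<^sup>2 * (L * norm x)) * norm (((*v) A ^^ k) x)"
        by (simp add: o mult.assoc)
    qed
    also have "\<dots> = (c\<^sup>2 * (L * norm x)) * (\<Sum>k. norm (((*v) A ^^ k) x))"
      by (rule suminf_mult[OF sm])
    also have "\<dots> \<le> (c\<^sup>2 * (L * norm x)) * (L * norm x)"
      using L by (intro mult_left_mono le) auto
    finally show ?thesis by (simp add: power2_eq_square algebra_simps)
  qed
  then show ?thesis using that[of "c\<^sup>2 * L\<^sup>2"] by simp
qed

text \<open>A long delay separates the two responses in time: the delayed one keeps its energy, and
  the inner product with the decaying first one tends to zero.\<close>

lemma energy_delay_tendsto: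
  assumes u: "u \<in> finite_signals" and v: "v \<in> finite_signals"
  shows "(\<lambda>n. energy A B C D 0 (\<lambda>k. u k + delay n v k))
     \<longlonglongrightarrow> energy A B C D 0 u + energy A B C D 0 v"
proof -
  let ?y = "outp A B C D 0 u" and ?z = "outp A B C D 0 v"
  let ?d = "\<lambda>n. outp A B C D 0 (delay n v)"
  note sm = summable_norm_outp[where C = C and D = D and x = 0]
  note sq = summable_energy[where C = C and D = D and x = 0]
  have dv: "delay n v \<in> finite_signals" for n by (rule finite_signals_delay[OF v])
  define M where "M = (\<Sum>k. norm (?z k))"
  have zM: "norm (?z k) \<le> M" for k
    using sum_le_suminf[OF sm[OF v], of "{k}"] by (simp add: M_def)
  have dM: "norm (?d n k) \<le> M" for n k
    using zM suminf_nonneg[OF sm[OF v]] by (simp add: outp_delay M_def)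
  have cs: "summable (\<lambda>k. ?y k \<bullet> ?d n k)" for n
    by (rule summable_comparison_test'[OF summable_mult2[OF sm[OF u], of M], of 0])
       (auto intro!: order_trans[OF Cauchy_Schwarz_ineq2] mult_left_mono dM)
  have ed: "energy A B C D 0 (delay n v) = energy A B C D 0 v" for n
    unfolding energy_def using suminf_split_initial_segment[OF sq[OF dv], of n n]
    by (simp add: outp_delay)
  have exp: "energy A B C D 0 (\<lambda>k. u k + delay n v k)
      = energy A B C D 0 u + energy A B C D 0 v + 2 * (\<Sum>k. ?y k \<bullet> ?d n k)" for n
  proof -
    have "energy A B C D 0 (\<lambda>k. u k + delay n v k)
      = (\<Sum>k. ((norm (?y k))\<^sup>2 + (norm (?d n k))\<^sup>2) + 2 * (?y k \<bullet> ?d n k))"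
      unfolding energy_def using outp_add[of A B C D 0 0 u "delay n v"]
      by (simp add: power2_norm_eq_inner inner_simps inner_commute algebra_simps)
    also have "\<dots> = energy A B C D 0 u + energy A B C D 0 (delay n v) + 2 * (\<Sum>k. ?y k \<bullet> ?d n k)"
      unfolding energy_def
      using suminf_linear_combination[OF summable_add[OF sq[OF u] sq[OF dv[of n]]] cs[of n], where a = 1 and b = 2]
      by (simp add: suminf_add[OF sq[OF u] sq[OF dv]])
    finally show ?thesis by (simp add: ed)
  qed
  \<comment> \<open>The delayed output vanishes before time \<open>n\<close>, so only the tail of
    the summable sequence \<open>?y\<close> contributes.\<close>
  have cross: "norm (\<Sum>k. ?y k \<bullet> ?d n k) \<le> (\<Sum>k. norm (?y (k + n))) * M" for n
  proof -
    have "(\<Sum>k. ?y k \<bullet> ?d n k) = (\<Sum>k. ?y (k + n) \<bullet> ?z k)"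
      using suminf_split_initial_segment[OF cs[of n], of n] by (simp add: outp_delay)
    also have "norm \<dots> \<le> (\<Sum>k. norm (?y (k + n)) * M)"
      by (intro norm_suminf_le summable_mult2 summable_ignore_initial_segment sm u)
         (auto intro!: order_trans[OF Cauchy_Schwarz_ineq2] mult_left_mono zM)
    finally show ?thesis
      using suminf_mult2[OF summable_ignore_initial_segment[OF sm[OF u], of n], of M] by simp
  qed
  have "(\<lambda>n. \<Sum>k. norm (?y (k + n))) \<longlonglongrightarrow> 0"
    using tendsto_diff[OF tendsto_const[of "\<Sum>k. norm (?y k)"] summable_LIMSEQ[OF sm[OF u]]]
      suminf_minus_initial_segment[OF sm[OF u]] by simp
  then have "(\<lambda>n. (\<Sum>k. norm (?y (k + n))) * M) \<longlonglongrightarrow> 0" by (rule tendsto_mult_left_zero)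
  then have "(\<lambda>n. \<Sum>k. ?y k \<bullet> ?d n k) \<longlonglongrightarrow> 0"
    by (rule Lim_null_comparison[OF always_eventually, rotated]) (use cross in blast)
  then show ?thesis unfolding exp by (auto intro!: tendsto_eq_intros)
qed

section \<open>Multipliers and storage matrices\<close>

text \<open>The matrix represents the available storage, the supremum of the net supply
  \<open>Q\<close> over finite signals. The hypothesis \<open>le\<close> speaks only of the initial
  state \<open>0\<close>; passing from \<open>x\<close> to \<open>0\<close> in the performance
  energy and back in the residual energies costs a factor \<open>1 + h\<close> each, whence
  \<open>(1 + h)\<^sup>2\<close>.\<close>

lemma storage_matrix_exists:
  fixes Cp :: "real^'x^'p" and Dp :: "real^'u^'p"
    and C :: "'N::finite \<Rightarrow> real^'x^'r" and D :: "'N \<Rightarrow> real^'u^'r" and g :: "'N \<Rightarrow> real"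
  assumes c: "c \<ge> 0" and g: "\<And>i. g i \<ge> 0" and h: "h > 0"
    and le: "\<And>u. u \<in> finite_signals \<Longrightarrow>
      c * energy A B Cp Dp 0 u \<le> (\<Sum>i\<in>UNIV. g i * energy A B (C i) (D i) 0 u)"
  obtains P where "transpose P = P"
    "\<And>x w. (A *v x + B *v w) \<bullet> (P *v (A *v x + B *v w)) - x \<bullet> (P *v x)
       + c * (norm (Cp *v x + Dp *v w))\<^sup>2
       - (\<Sum>i\<in>UNIV. (1 + h)\<^sup>2 * g i * (norm (C i *v x + D i *v w))\<^sup>2) \<le> 0"
proof -
  let ?E = "energy A B Cp Dp" and ?R = "\<lambda>i. energy A B (C i) (D i)"
  define Q where "Q x u = c * ?E x u - (\<Sum>i\<in>UNIV. (1 + h)\<^sup>2 * g i * ?R i x u)" for x u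
  define V where "V x = (SUP u\<in>finite_signals. Q x u)" for x
  obtain m where m: "m \<ge> 0" "\<And>x. ?E x (\<lambda>_. 0) \<le> m * (norm x)\<^sup>2"
    using free_energy_bound by blast
  have "\<forall>i. \<exists>r. r \<ge> 0 \<and> (\<forall>x. ?R i x (\<lambda>_. 0) \<le> r * (norm x)\<^sup>2)"
    using free_energy_bound by metis
  then obtain r where r: "\<And>i. r i \<ge> 0" "\<And>i x. ?R i x (\<lambda>_. 0) \<le> r i * (norm x)\<^sup>2" by metis
  \<comment> \<open>\<open>M\<close> collects the free-response terms of both uses of Young's
    inequality; \<open>M'\<close> bounds the residual cost of the zero signal and so gives a lower
    bound for \<open>V\<close>.\<close>
  define M where "M = c * (1 + 1 / h) * m + (\<Sum>i\<in>UNIV. (1 + h) * (1 + 1 / h) * g i * r i)"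
  define M' where "M' = (\<Sum>i\<in>UNIV. (1 + h)\<^sup>2 * g i * r i)"
  have nonneg: "M \<ge> 0" "M' \<ge> 0"
    using c m r g h by (auto simp: M_def M'_def intro!: add_nonneg_nonneg sum_nonneg)
  have Q_le: "Q x u \<le> M * (norm x)\<^sup>2" if u: "u \<in> finite_signals" for x u
  proof -
    have expand: "a * (g' * (a * R + b * (r' * n))) = a\<^sup>2 * g' * R + a * b * g' * r' * n"
      for a b g' R r' n :: real
      by (simp add: algebra_simps power2_eq_square)
    have "?E x u \<le> (1 + h) * ?E 0 u + (1 + 1 / h) * ?E x (\<lambda>_. 0)"
      using energy_add_le[OF u finite_signals_zero h, of Cp Dp 0 x] by simp
    also have "\<dots> \<le> (1 + h) * ?E 0 u + (1 + 1 / h) * (m * (norm x)\<^sup>2)"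
      using h by (intro add_left_mono mult_left_mono m) auto
    finally have "c * ?E x u \<le> c * ((1 + h) * ?E 0 u + (1 + 1 / h) * (m * (norm x)\<^sup>2))"
      using c by (rule mult_left_mono)
    also have "\<dots> = (1 + h) * (c * ?E 0 u) + c * (1 + 1 / h) * m * (norm x)\<^sup>2"
      by (simp add: algebra_simps)
    also have "(1 + h) * (c * ?E 0 u) \<le> (1 + h) * (\<Sum>i\<in>UNIV. g i * ?R i 0 u)"
      using h by (intro mult_left_mono le u) auto
    also have "\<dots> \<le> (1 + h) * (\<Sum>i\<in>UNIV. g i * ((1 + h) * ?R i x u + (1 + 1 / h) * (r i * (norm x)\<^sup>2)))"
    proof (intro mult_left_mono sum_mono g)
      fix i
      \<comment> \<open>The response from \<open>0\<close> is the one from \<open>x\<close> plus the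
        free response from \<open>- x\<close>.\<close>
      have "?R i 0 u \<le> (1 + h) * ?R i x u + (1 + 1 / h) * ?R i (- x) (\<lambda>_. 0)"
        using energy_add_le[OF u finite_signals_zero h, of "C i" "D i" x "- x"] by simp
      also have "\<dots> \<le> (1 + h) * ?R i x u + (1 + 1 / h) * (r i * (norm (- x))\<^sup>2)"
        using h by (intro add_left_mono mult_left_mono r) auto
      finally show "?R i 0 u \<le> (1 + h) * ?R i x u + (1 + 1 / h) * (r i * (norm x)\<^sup>2)" by simp
    qed (use h in auto)
    also have "\<dots> = (\<Sum>i\<in>UNIV. (1 + h)\<^sup>2 * g i * ?R i x u)
        + (\<Sum>i\<in>UNIV. (1 + h) * (1 + 1 / h) * g i * r i) * (norm x)\<^sup>2"
      unfolding sum_distrib_left sum_distrib_right sum.distrib[symmetric]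
      by (intro sum.cong refl) (rule expand)
    finally show ?thesis by (simp add: Q_def M_def distrib_right)
  qed
  have bdd: "bdd_above (Q x ` finite_signals)" for x
    using Q_le by (auto simp: bdd_above_def)
  have QV: "Q x u \<le> V x" if "u \<in> finite_signals" for x u
    unfolding V_def by (rule cSUP_upper[OF that bdd])
  have V_least: "V x \<le> z" if "\<And>u. u \<in> finite_signals \<Longrightarrow> Q x u \<le> z" for x z
    unfolding V_def using finite_signals_zero that by (intro cSUP_least) auto
  have Q_scale: "Q (t *\<^sub>R x) (\<lambda>k. t *\<^sub>R u k) = t\<^sup>2 * Q x u" if "u \<in> finite_signals" for t x u
    by (simp add: Q_def energy_scaleR[OF that] right_diff_distrib sum_distrib_left mult_ac)
  have Q_par: "Q (x + y) (\<lambda>k. u k + v k) + Q (x - y) (\<lambda>k. u k - v k) = 2 * Q x u + 2 * Q y v"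
    if uv: "u \<in> finite_signals" "v \<in> finite_signals" for x y u v
  proof -
    have "Q (x + y) (\<lambda>k. u k + v k) + Q (x - y) (\<lambda>k. u k - v k)
      = c * (?E (x + y) (\<lambda>k. u k + v k) + ?E (x - y) (\<lambda>k. u k - v k))
        - (\<Sum>i\<in>UNIV. (1 + h)\<^sup>2 * g i * (?R i (x + y) (\<lambda>k. u k + v k) + ?R i (x - y) (\<lambda>k. u k - v k)))"
      by (simp add: Q_def distrib_left sum.distrib)
    also have "\<dots> = 2 * Q x u + 2 * Q y v"
      unfolding energy_parallelogram[OF uv]
      by (simp add: Q_def distrib_left right_diff_distrib sum.distrib sum_distrib_left mult_ac)
    finally show ?thesis .
  qed
  \<comment> \<open>The signals for \<open>x\<close> and \<open>y\<close> can be chosen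
    independently, and their sum and difference compete in the suprema on the right; hence take one
    supremum after the other.\<close>
  have V_super: "2 * V x + 2 * V y \<le> V (x + y) + V (x - y)" for x y
  proof -
    let ?z = "V (x + y) + V (x - y)"
    have *: "2 * Q x u + 2 * Q y v \<le> ?z" if uv: "u \<in> finite_signals" "v \<in> finite_signals" for u v
      unfolding Q_par[OF uv, symmetric]
      by (intro add_mono QV finite_signals_add finite_signals_diff uv)
    have "V y \<le> (?z - 2 * Q x u) / 2" if u: "u \<in> finite_signals" for u
      using *[OF u] by (intro V_least) (simp add: field_simps)
    then have "V x \<le> (?z - 2 * V y) / 2"
      by (intro V_least) (force simp: field_simps)
    then show ?thesis by simp
  qed
  have V_double: "V (2 *\<^sub>R x) \<le> 4 * V x" for x
  proof (rule V_least)
    fix u :: "nat \<Rightarrow> real^'u" assume "u \<in> finite_signals"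
    then have half: "(\<lambda>k. (1/2) *\<^sub>R u k) \<in> finite_signals" by (rule finite_signals_scaleR)
    show "Q (2 *\<^sub>R x) u \<le> 4 * V x" using Q_scale[OF half, of 2 x] QV[OF half, of x] by simp
  qed
  text \<open>The converse of \<open>V_super\<close> is \<open>V_super\<close> itself, applied to \<open>x + y\<close> and \<open>x - y\<close>.\<close>
  have par: "V (x + y) + V (x - y) = 2 * V x + 2 * V y" for x y
  proof -
    have e: "(x + y) + (x - y) = 2 *\<^sub>R x" "(x + y) - (x - y) = 2 *\<^sub>R y"
      by (simp_all add: scaleR_2)
    show ?thesis
      using V_super[of x y] V_super[of "x + y" "x - y"] V_double[of x] V_double[of y]
      unfolding e by linarith
  qed
  have bound: "\<bar>V x\<bar> \<le> (M + M') * (norm x)\<^sup>2" for x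
  proof -
    have "V x \<le> M * (norm x)\<^sup>2" by (rule V_least[OF Q_le])
    moreover have "- M' * (norm x)\<^sup>2 \<le> V x"
    proof -
      have "(\<Sum>i\<in>UNIV. (1 + h)\<^sup>2 * g i * ?R i x (\<lambda>_. 0)) \<le> (\<Sum>i\<in>UNIV. (1 + h)\<^sup>2 * g i * (r i * (norm x)\<^sup>2))"
        using h g by (intro sum_mono mult_left_mono r) auto
      also have "\<dots> = M' * (norm x)\<^sup>2"
        by (simp add: M'_def sum_distrib_right mult.assoc)
      finally have "- M' * (norm x)\<^sup>2 \<le> Q x (\<lambda>_. 0)"
        using mult_nonneg_nonneg[OF c energy_nonneg[OF finite_signals_zero, of Cp Dp x]]
        by (simp add: Q_def)
      also have "\<dots> \<le> V x" by (rule QV[OF finite_signals_zero])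
      finally show ?thesis .
    qed
    moreover have "M * (norm x)\<^sup>2 \<ge> 0" "M' * (norm x)\<^sup>2 \<ge> 0" using nonneg by auto
    ultimately show ?thesis by (simp add: distrib_right)
  qed
  obtain P where P: "transpose P = P" "\<And>x. V x = x \<bullet> (P *v x)"
    using parallelogram_imp_quadratic_form[OF par bound] by blast
  show ?thesis
  proof (rule that[OF P(1)])
    fix x w
    let ?s = "c * (norm (Cp *v x + Dp *v w))\<^sup>2
       - (\<Sum>i\<in>UNIV. (1 + h)\<^sup>2 * g i * (norm (C i *v x + D i *v w))\<^sup>2)"
    \<comment> \<open>Bellman's inequality: playing \<open>w\<close> and then a nearly optimal
      \<open>u\<close> from the successor state is one of the options at \<open>x\<close>.\<close>
    have "V (A *v x + B *v w) \<le> V x - ?s"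
    proof (rule V_least)
      fix u :: "nat \<Rightarrow> real^'u" assume u: "u \<in> finite_signals"
      have "Q x (case_nat w u) = ?s + Q (A *v x + B *v w) u"
        by (simp add: Q_def energy_step[OF u] distrib_left sum.distrib)
      then show "Q (A *v x + B *v w) u \<le> V x - ?s"
        using QV[OF finite_signals_case_nat[OF u], of x w] by simp
    qed
    then show "(A *v x + B *v w) \<bullet> (P *v (A *v x + B *v w)) - x \<bullet> (P *v x)
       + c * (norm (Cp *v x + Dp *v w))\<^sup>2
       - (\<Sum>i\<in>UNIV. (1 + h)\<^sup>2 * g i * (norm (C i *v x + D i *v w))\<^sup>2) \<le> 0"
      unfolding P(2) by simp
  qed
qed

text \<open>The S-procedure applied to the attainable vectors of energies. Scaling signals makes
  them a cone, and delays put sums of two such vectors into the closure.\<close>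

lemma stacked_multipliers:
  fixes Cp :: "real^'x^'p" and Dp :: "real^'u^'p"
    and C :: "'N::finite \<Rightarrow> real^'x^'r" and D :: "'N \<Rightarrow> real^'u^'r"
  assumes c: "c \<ge> 0"
    and b: "\<And>u. u \<in> finite_signals \<Longrightarrow> (\<And>i. energy A B (C i) (D i) 0 u \<le> 1)
      \<Longrightarrow> c * energy A B Cp Dp 0 u \<le> b"
  obtains g :: "real^'N" where "\<And>i. g $ i \<ge> 0" "1 \<bullet> g \<le> b"
    "\<And>u. u \<in> finite_signals \<Longrightarrow>
      c * energy A B Cp Dp 0 u \<le> (\<Sum>i\<in>UNIV. g $ i * energy A B (C i) (D i) 0 u)"
proof -
  define F where "F u = (c * energy A B Cp Dp 0 u, \<chi> i. energy A B (C i) (D i) 0 u)" for u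
  have z: "0 \<in> F ` finite_signals"
  proof -
    have "F (\<lambda>_. 0) = 0" by (simp add: F_def energy_zero zero_prod_def vec_eq_iff)
    then show ?thesis using finite_signals_zero by (metis image_eqI)
  qed
  have sc: "t *\<^sub>R s \<in> F ` finite_signals" if "t \<ge> 0" "s \<in> F ` finite_signals" for t s
  proof -
    from that obtain u where u: "u \<in> finite_signals" and s: "s = F u" by blast
    \<comment> \<open>The square root appears because energies are quadratic in the signal.\<close>
    have "F (\<lambda>k. sqrt t *\<^sub>R u k) = t *\<^sub>R s"
      using that(1) energy_scaleR[OF u, of Cp Dp "sqrt t" 0]
        energy_scaleR[OF u, of "C _" "D _" "sqrt t" 0]
      by (simp add: F_def s vec_eq_iff)
    then show ?thesis using finite_signals_scaleR[OF u] by (metis image_eqI)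
  qed
  have ad: "s + t \<in> closure (F ` finite_signals)"
    if "s \<in> F ` finite_signals" "t \<in> F ` finite_signals" for s t
  proof -
    from that obtain u v where uv: "u \<in> finite_signals" "v \<in> finite_signals"
      and s: "s = F u" "t = F v" by blast
    note lim = energy_delay_tendsto[OF uv]
    have "(\<lambda>n. F (\<lambda>k. u k + delay n v k)) \<longlonglongrightarrow>
       (c * (energy A B Cp Dp 0 u + energy A B Cp Dp 0 v),
        \<chi> i. energy A B (C i) (D i) 0 u + energy A B (C i) (D i) 0 v)"
      unfolding F_def by (intro tendsto_Pair tendsto_mult_left tendsto_vec_lambda lim)
    moreover have "(c * (energy A B Cp Dp 0 u + energy A B Cp Dp 0 v),
        \<chi> i. energy A B (C i) (D i) 0 u + energy A B (C i) (D i) 0 v) = s + t"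
      by (simp add: s F_def vec_eq_iff distrib_left)
    ultimately have "(\<lambda>n. F (\<lambda>k. u k + delay n v k)) \<longlonglongrightarrow> s + t" by simp
    moreover have "F (\<lambda>k. u k + delay n v k) \<in> closure (F ` finite_signals)" for n
      using closure_subset finite_signals_add[OF uv(1) finite_signals_delay[OF uv(2)]] by blast
    ultimately show ?thesis by (rule closed_sequentially[OF closed_closure, rotated])
  qed
  have bd: "fst s \<le> b" if "s \<in> F ` finite_signals" "\<And>i. snd s $ i \<le> 1" for s
    using that b by (auto simp: F_def)
  obtain g where g: "\<And>i. 0 \<le> g $ i" "(1 :: real^'N) \<bullet> g \<le> b"
      "\<And>s. s \<in> F ` finite_signals \<Longrightarrow> fst s \<le> g \<bullet> snd s"
    using lossless_s_procedure[of "F ` finite_signals" b, OF z sc ad bd] by blast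
  show ?thesis
    by (rule that[OF g(1,2)]) (use g(3)[OF imageI] in \<open>simp add: F_def inner_vec_def\<close>)
qed

end

section \<open>Block matrices and the linear matrix inequality\<close>

definition lpart :: "'b^('m::finite + 'n::finite) \<Rightarrow> 'b^'m"
  where "lpart z = (\<chi> i. z $ Inl i)"

definition rpart :: "'b^('m::finite + 'n::finite) \<Rightarrow> 'b^'n"
  where "rpart z = (\<chi> i. z $ Inr i)"

text \<open>The entry type is left open so that \<open>blk\<close> also extracts block rows: a
  matrix is a vector of its rows.\<close>

definition blk :: "'N \<Rightarrow> 'b^('N::finite \<times> 'm::finite) \<Rightarrow> 'b^'m"
  where "blk i z = (\<chi> j. z $ (i, j))"

lemma sum_UNIV_sum_type:
  fixes f :: "'m::finite + 'n::finite \<Rightarrow> 'b::comm_monoid_add"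
  shows "(\<Sum>k\<in>UNIV. f k) = (\<Sum>i\<in>UNIV. f (Inl i)) + (\<Sum>j\<in>UNIV. f (Inr j))"
  by (simp add: UNIV_Plus_UNIV[symmetric] sum.Plus del: UNIV_Plus_UNIV)

lemma sum_UNIV_prod_type:
  fixes f :: "'m::finite \<times> 'n::finite \<Rightarrow> 'b::comm_monoid_add"
  shows "(\<Sum>p\<in>UNIV. f p) = (\<Sum>i\<in>UNIV. \<Sum>j\<in>UNIV. f (i, j))"
  by (simp add: UNIV_Times_UNIV[symmetric] sum.cartesian_product del: UNIV_Times_UNIV)

section \<open>Action of block matrices on vectors\<close>

lemma hcat_mult_vec: "(M <|> N) *v z = M *v lpart z + N *v rpart z"
  by (simp add: hcat_def lpart_def rpart_def vec_eq_iff matrix_vector_mult_def sum_UNIV_sum_type)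

lemma inner_vcat_mult_vec: "z \<bullet> ((M <#> N) *v w) = lpart z \<bullet> (M *v w) + rpart z \<bullet> (N *v w)"
  by (simp add: vcat_def lpart_def rpart_def inner_vec_def matrix_vector_mult_def sum_UNIV_sum_type)

lemma blk_mult_vec: "blk i M *v x = blk i (M *v x)"
  by (simp add: blk_def vec_eq_iff matrix_vector_mult_def)

lemma blk_add: "blk i (x + y) = blk i x + blk i y"
  by (simp add: blk_def vec_eq_iff)

lemma blk_blkdiag_mult_vec: "blk i (blkdiag M *v z) = M i *v blk i z"
proof -
  have "(\<Sum>k\<in>UNIV. \<Sum>l\<in>UNIV. (if i = k then M i $ j $ l else 0) * z $ (k, l))
      = (\<Sum>k\<in>UNIV. if i = k then \<Sum>l\<in>UNIV. M i $ j $ l * z $ (k, l) else 0)" for j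
    by (rule sum.cong) auto
  then show ?thesis
    by (simp add: blk_def blkdiag_def vec_eq_iff matrix_vector_mult_def sum_UNIV_prod_type
      cong: if_cong)
qed

lemma blk_vstack: "blk i (vstack M) = M i"
  by (simp add: blk_def vstack_def)

lemma blk_vstack_mult_vec: "blk i (vstack M *v u) = M i *v u"
  by (simp add: blk_mult_vec[symmetric] blk_vstack)

lemma inner_eq_sum_blk: "z \<bullet> w = (\<Sum>i\<in>UNIV. blk i z \<bullet> blk i w)"
  by (simp add: inner_vec_def blk_def sum_UNIV_prod_type)

lemma blk_kron_diag_mult_vec: "blk i (kron (diag g) (mat 1) *v y) = g $ i *\<^sub>R blk i y"
proof -
  have "(\<Sum>l\<in>UNIV. (if i = k then g $ i else 0) * (if j = l then 1 else 0) * y $ (k, l))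
      = (\<Sum>l\<in>UNIV. if j = l then (if i = k then g $ i * y $ (k, l) else 0) else 0)" for j k
    by (rule sum.cong) auto
  then show ?thesis
    by (simp add: blk_def kron_def diag_def mat_def vec_eq_iff matrix_vector_mult_def sum_UNIV_prod_type
      cong: if_cong)
qed

lemma inner_transpose_mult_vec: "x \<bullet> (transpose M *v y) = (M *v x) \<bullet> y" for M :: "real^'n^'m"
  by (metis dot_lmul_matrix inner_commute transpose_matrix_vector)

lemma transpose_eq_self_iff:
  "transpose M = M \<longleftrightarrow> (\<forall>z w. z \<bullet> (M *v w) = w \<bullet> (M *v z))" for M :: "real^'n^'n"
proof
  assume "transpose M = M"
  then show "\<forall>z w. z \<bullet> (M *v w) = w \<bullet> (M *v z)"
    by (metis inner_transpose_mult_vec inner_commute)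
next
  assume *: "\<forall>z w. z \<bullet> (M *v w) = w \<bullet> (M *v z)"
  have "z \<bullet> (transpose M *v w) = z \<bullet> (M *v w)" for z w
    using * by (metis inner_transpose_mult_vec inner_commute)
  then have "transpose M *v w = M *v w" for w
    by (metis vector_eq_ldot)
  then show "transpose M = M" by (simp add: matrix_eq)
qed

text \<open>The bilinear form, rather than only the quadratic one, also gives the symmetry that
  \<open>neg_semidef\<close> demands, through \<open>transpose_eq_self_iff\<close>.\<close>

lemma inner_lmi_matrix:
  "z \<bullet> (lmi_matrix A B P *v w)
   = (A *v lpart z + B *v rpart z) \<bullet> (P *v (A *v lpart w + B *v rpart w)) - lpart z \<bullet> (P *v lpart w)"
proof -
  have 1: "lpart z \<bullet> (((transpose A ** P ** A - P) <|> (transpose A ** P ** B)) *v w)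
     = (A *v lpart z) \<bullet> (P *v (A *v lpart w + B *v rpart w)) - lpart z \<bullet> (P *v lpart w)"
    by (simp add: hcat_mult_vec matrix_vector_mult_diff_rdistrib matrix_vector_mul_assoc[symmetric]
        inner_add_right inner_diff_right inner_transpose_mult_vec matrix_vector_right_distrib
        del: transpose_matrix_vector)
  have 2: "rpart z \<bullet> (((transpose B ** P ** A) <|> (transpose B ** P ** B)) *v w)
     = (B *v rpart z) \<bullet> (P *v (A *v lpart w + B *v rpart w))"
    by (simp add: hcat_mult_vec matrix_vector_mul_assoc[symmetric]
        inner_add_right inner_transpose_mult_vec matrix_vector_right_distrib
        del: transpose_matrix_vector)
  show ?thesis
    unfolding lmi_matrix_def inner_vcat_mult_vec 1 2 by (simp add: inner_add_left)
qed

lemma inner_factored: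
  "z \<bullet> (((transpose C <#> transpose D) ** K ** (C <|> D)) *v w)
   = (C *v lpart z + D *v rpart z) \<bullet> (K *v (C *v lpart w + D *v rpart w))"
  by (simp add: matrix_vector_mul_assoc[symmetric] inner_vcat_mult_vec hcat_mult_vec
      inner_transpose_mult_vec inner_add_left del: transpose_matrix_vector)

lemma inner_Psi:
  fixes g :: "real^'N::finite"
  shows "z \<bullet> (Psi Cp Dp Cr Dr g *v w)
   = 1 / real CARD('N) * ((Cp *v lpart z + Dp *v rpart z) \<bullet> (Cp *v lpart w + Dp *v rpart w))
     - (\<Sum>i\<in>UNIV. g $ i * (blk i (Cr *v lpart z + Dr *v rpart z) \<bullet> blk i (Cr *v lpart w + Dr *v rpart w)))"
  using inner_factored[of z Cp Dp "mat 1" w]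
  by (simp add: Psi_def matrix_vector_mult_diff_rdistrib inner_diff_right inner_factored
      scaleR_matrix_vector_assoc[symmetric] inner_eq_sum_blk[of _ "kron _ _ *v _"]
      blk_kron_diag_mult_vec)

text \<open>Read as a quadratic form in state and input, the matrix inequality is a dissipation
  inequality with storage \<open>P\<close>.\<close>

lemma lmi_neg_semidef_iff:
  fixes g :: "real^'N::finite" and A :: "real^('N \<times> 'x::finite)^('N \<times> 'x)" and B :: "real^'a^('N \<times> 'x)"
  assumes P: "transpose P = P"
  shows "neg_semidef (lmi_matrix A B P + Psi Cp Dp Cr Dr g) \<longleftrightarrow>
    (\<forall>x u. (A *v x + B *v u) \<bullet> (P *v (A *v x + B *v u)) - x \<bullet> (P *v x)
      + 1 / real CARD('N) * (norm (Cp *v x + Dp *v u))\<^sup>2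
      - (\<Sum>i\<in>UNIV. g $ i * (norm (blk i (Cr *v x + Dr *v u)))\<^sup>2) \<le> 0)" (is "_ = (\<forall>x u. ?q x u \<le> 0)")
proof -
  let ?M = "lmi_matrix A B P + Psi Cp Dp Cr Dr g"
  have split: "z \<bullet> (?M *v w) = z \<bullet> (lmi_matrix A B P *v w) + z \<bullet> (Psi Cp Dp Cr Dr g *v w)" for z w
    by (simp add: matrix_vector_mult_add_rdistrib inner_add_right)
  note form = split inner_lmi_matrix inner_Psi
  have P_sym: "z \<bullet> (P *v w) = w \<bullet> (P *v z)" for z w
    using P by (simp add: transpose_eq_self_iff)
  have "z \<bullet> (?M *v w) = w \<bullet> (?M *v z)" for z w
    unfolding form
    by (intro arg_cong2[where f = "(+)"] arg_cong2[where f = "(-)"] arg_cong2[where f = "(*)"]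
        sum.cong refl P_sym inner_commute)
  then have "transpose ?M = ?M" by (simp add: transpose_eq_self_iff)
  moreover have "z \<bullet> (?M *v z) = ?q (lpart z) (rpart z)" for z
    unfolding form power2_norm_eq_inner by simp
  ultimately have "neg_semidef ?M \<longleftrightarrow> (\<forall>z. ?q (lpart z) (rpart z) \<le> 0)"
    by (simp add: neg_semidef_def)
  moreover have "(\<forall>z. ?q (lpart z) (rpart z) \<le> 0) \<longleftrightarrow> (\<forall>x u. ?q x u \<le> 0)"
  proof (intro iffI allI)
    fix x :: "real^('N \<times> 'x)" and u :: "real^'a"
    assume *: "\<forall>z. ?q (lpart z) (rpart z) \<le> 0"
    define z :: "real^(('N \<times> 'x) + 'a)" where "z = (\<chi> k. case k of Inl i \<Rightarrow> x $ i | Inr j \<Rightarrow> u $ j)"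
    have "lpart z = x" "rpart z = u" by (simp_all add: z_def lpart_def rpart_def)
    with *[rule_format, of z] show "?q x u \<le> 0" by simp
  qed blast
  ultimately show ?thesis by simp
qed

section \<open>Relating the stacked system to the individual loops\<close>

lemma blk_traj:
  "blk i (traj (blkdiag A) (vstack B) x u k) = traj (A i) (B i) (blk i x) u k"
  by (induction k) (simp_all add: blk_add blk_blkdiag_mult_vec blk_vstack_mult_vec)

lemma state_traj_eq_traj: "state_traj A B u k = traj A B 0 u k"
  by (induction k) simp_all

lemma output_traj_eq_outp: "output_traj A B C D u k = outp A B C D 0 u k"
  by (simp add: output_traj_def outp_def state_traj_eq_traj)

lemma blk_zero: "blk i 0 = 0"
  by (simp add: blk_def vec_eq_iff)

lemma blk_outp:
  "blk i (outp (blkdiag A) (vstack B) (blkdiag C) (vstack D) 0 u k) = output_traj (A i) (B i) (C i) (D i) u k"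
  by (simp add: output_traj_eq_outp outp_def blk_add blk_blkdiag_mult_vec blk_vstack_mult_vec
      blk_traj blk_zero)

text \<open>The block row \<open>blk i (blkdiag C)\<close> reads the output of the single loop
  \<open>i\<close> off the stacked state, so every residual becomes an output of one common
  system.\<close>

lemma outp_blk:
  "outp (blkdiag A) (vstack B) (blk i (blkdiag C)) (blk i (vstack D)) 0 u k
    = output_traj (A i) (B i) (C i) (D i) u k"
  by (simp add: blk_outp[symmetric]) (simp add: outp_def blk_mult_vec blk_add)

lemma norm_outp_blkdiag:
  "(norm (outp (blkdiag A) (vstack B) (blkdiag C) (vstack D) 0 u k))\<^sup>2
    = (\<Sum>i\<in>UNIV. output_traj (A i) (B i) (C i) (D i) u k \<bullet> output_traj (A i) (B i) (C i) (D i) u k)"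
  by (simp add: power2_norm_eq_inner inner_eq_sum_blk[of "outp _ _ _ _ _ _ _"] blk_outp)

lemma tendsto_zero_blkI:
  assumes "\<And>i. (\<lambda>k. blk i (f k)) \<longlonglongrightarrow> 0"
  shows "f \<longlonglongrightarrow> (0 :: real^('N::finite \<times> 'm::finite))"
proof (rule vec_tendstoI)
  fix p :: "'N \<times> 'm"
  have "(\<lambda>k. blk (fst p) (f k) $ snd p) \<longlonglongrightarrow> 0 $ snd p" by (intro tendsto_vec_nth assms)
  then show "(\<lambda>k. f k $ p) \<longlonglongrightarrow> 0 $ p" by (simp add: blk_def)
qed

lemma attractive_blkdiag:
  fixes A :: "'N::finite \<Rightarrow> real^'x::finite^'x"
  assumes "\<And>i x. (\<lambda>k. ((*v) (A i) ^^ k) x) \<longlonglongrightarrow> 0"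
  shows "(\<lambda>k. ((*v) (blkdiag A) ^^ k) x) \<longlonglongrightarrow> 0"
proof (rule tendsto_zero_blkI)
  fix i
  have "blk i (((*v) (blkdiag A) ^^ k) x) = ((*v) (A i) ^^ k) (blk i x)" for k
    by (induction k) (simp_all add: blk_blkdiag_mult_vec)
  then show "(\<lambda>k. blk i (((*v) (blkdiag A) ^^ k) x)) \<longlonglongrightarrow> 0" using assms by simp
qed

lemma sum_l2_norm_sq_blocks:
  "(\<Sum>i\<in>UNIV. l2_norm_sq (output_traj (A i) (B i) (C i) (D i) u))
    = (\<Sum>k. ereal ((norm (outp (blkdiag A) (vstack B) (blkdiag C) (vstack D) 0 u k))\<^sup>2))"
  unfolding l2_norm_sq_def norm_outp_blkdiag sum_ereal[symmetric]
  by (subst suminf_sum_ereal) auto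

text \<open>Summing the dissipation inequality along the trajectory telescopes the storage, and the
  multipliers weigh residual energies of at most \<open>1\<close>. The performance energy stays an
  extended real, since its finiteness is part of the conclusion.\<close>

lemma weak_duality:
  fixes g :: "real^'N::finite"
  assumes g: "\<And>i. 0 \<le> g $ i"
    and diss: "\<And>x u. (A *v x + B *v u) \<bullet> (P *v (A *v x + B *v u)) - x \<bullet> (P *v x)
      + c * (norm (Cp *v x + Dp *v u))\<^sup>2
      - (\<Sum>i\<in>UNIV. g $ i * (norm (C i *v x + D i *v u))\<^sup>2) \<le> 0"
    and c: "c \<ge> 0"
    and lim: "traj A B 0 a \<longlonglongrightarrow> 0"
    and res: "\<And>i. (\<Sum>k. ereal ((norm (outp A B (C i) (D i) 0 a k))\<^sup>2)) \<le> 1"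
  shows "ereal c * (\<Sum>k. ereal ((norm (outp A B Cp Dp 0 a k))\<^sup>2)) \<le> ereal (1 \<bullet> g)"
proof -
  let ?V = "\<lambda>k. traj A B 0 a k \<bullet> (P *v traj A B 0 a k)"
  let ?p = "\<lambda>k. c * (norm (outp A B Cp Dp 0 a k))\<^sup>2"
  let ?r = "\<lambda>i k. (norm (outp A B (C i) (D i) 0 a k))\<^sup>2"
  have step: "?p k \<le> ?V k - ?V (Suc k) + (\<Sum>i\<in>UNIV. g $ i * ?r i k)" for k
    using diss[of "traj A B 0 a k" "a k"] by (simp add: outp_def)
  have tele: "(\<Sum>k<K. ?p k) \<le> (\<Sum>i\<in>UNIV. g $ i * (\<Sum>k<K. ?r i k)) - ?V K" for K
  proof (induction K)
    case (Suc K)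
    then show ?case using step[of K] by (simp add: distrib_left sum.distrib)
  qed simp
  have r1: "(\<Sum>k<K. ?r i k) \<le> 1" for i K
  proof -
    have "ereal (\<Sum>k<K. ?r i k) \<le> (\<Sum>k. ereal (?r i k))"
      unfolding sum_ereal[symmetric] by (rule suminf_upper) simp
    then have "ereal (\<Sum>k<K. ?r i k) \<le> 1" using res order_trans by blast
    then show ?thesis by simp
  qed
  have part: "(\<Sum>k<K. ?p k) \<le> 1 \<bullet> g - ?V K" for K
  proof -
    have "(\<Sum>i\<in>UNIV. g $ i * (\<Sum>k<K. ?r i k)) \<le> (\<Sum>i\<in>UNIV. g $ i * 1)"
      by (intro sum_mono mult_left_mono g r1)
    also have "\<dots> = 1 \<bullet> g" by (simp add: inner_vec_def)
    finally show ?thesis using tele[of K] by simp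
  qed
  have V0: "?V \<longlonglongrightarrow> 0"
    using tendsto_inner[OF lim bounded_linear.tendsto[OF matrix_vector_mul_bounded_linear lim, of P]]
    by simp
  \<comment> \<open>For fixed \<open>K\<close> compare with the longer sums up to \<open>n\<close>
    and let \<open>n\<close> grow, so that the final storage disappears.\<close>
  have "(\<Sum>k<K. ?p k) \<le> 1 \<bullet> g" for K
  proof (rule LIMSEQ_le_const)
    show "(\<lambda>n. 1 \<bullet> g - ?V n) \<longlonglongrightarrow> 1 \<bullet> g" using tendsto_diff[OF tendsto_const V0] by simp
    show "\<exists>N. \<forall>n\<ge>N. (\<Sum>k<K. ?p k) \<le> 1 \<bullet> g - ?V n"
    proof (intro exI allI impI)
      fix n assume "K \<le> n"
      then have "(\<Sum>k<K. ?p k) \<le> (\<Sum>k<n. ?p k)" using c by (intro sum_mono2) auto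
      then show "(\<Sum>k<K. ?p k) \<le> 1 \<bullet> g - ?V n" using part[of n] by simp
    qed
  qed
  then have "(\<Sum>k. ereal (?p k)) \<le> ereal (1 \<bullet> g)"
    using c by (intro suminf_bound) auto
  moreover have "ereal c * (\<Sum>k. ereal ((norm (outp A B Cp Dp 0 a k))\<^sup>2)) = (\<Sum>k. ereal (?p k))"
    using c by (subst suminf_cmult_ereal[symmetric]) auto
  ultimately show ?thesis by simp
qed

lemma (in attractive_system) suminf_ereal_energy:
  assumes "u \<in> finite_signals"
  shows "(\<Sum>k. ereal ((norm (outp A B C D 0 u k))\<^sup>2)) = ereal (energy A B C D 0 u)"
  unfolding energy_def
  by (rule sums_unique[symmetric]) (simp add: sums_ereal summable_sums summable_energy assms)

lemma sdp_feasible_iff: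
  fixes S Ba Da and ds :: "'N::finite \<Rightarrow> real^'v"
  defines "A \<equiv> blkdiag (\<lambda>i. A_cl (S (ds i)))" and "B \<equiv> vstack (\<lambda>i. B_cl Ba Da (S (ds i)))"
    and "Cp \<equiv> blkdiag (\<lambda>i. C_p (S (ds i)))" and "Dp \<equiv> vstack (\<lambda>i. D_p Ba Da (S (ds i)))"
    and "Cr \<equiv> blkdiag (\<lambda>i. C_r (S (ds i)))" and "Dr \<equiv> vstack (\<lambda>i. D_r Ba Da (S (ds i)))"
  shows "(g, P) \<in> sdp_feasible Ba Da S ds \<longleftrightarrow> (\<forall>i. 0 \<le> g $ i) \<and> transpose P = P \<and>
    (\<forall>x u. (A *v x + B *v u) \<bullet> (P *v (A *v x + B *v u)) - x \<bullet> (P *v x)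
      + 1 / real CARD('N) * (norm (Cp *v x + Dp *v u))\<^sup>2
      - (\<Sum>i\<in>UNIV. g $ i * (norm (blk i Cr *v x + blk i Dr *v u))\<^sup>2) \<le> 0)"
  unfolding sdp_feasible_def assms mem_Collect_eq case_prod_conv blk_mult_vec blk_add[symmetric]
  by (intro conj_cong refl lmi_neg_semidef_iff)

text \<open>For fixed state and input the dissipation inequality is affine in \<open>(g, P)\<close>.
  Its constant part, \<open>z\<close> in \<open>comb\<close>, is preserved because the weights add
  up to \<open>1\<close>.\<close>

lemma convex_sdp_feasible: "convex (sdp_feasible Ba Da S ds)"
proof (rule convexI)
  fix p q and s t :: real
  assume p: "p \<in> sdp_feasible Ba Da S ds" and q: "q \<in> sdp_feasible Ba Da S ds"
    and st: "0 \<le> s" "0 \<le> t" "s + t = 1"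
  obtain g P where pe: "p = (g, P)" by force
  obtain g' P' where qe: "q = (g', P')" by force
  note p' = p[unfolded pe sdp_feasible_iff] and q' = q[unfolded qe sdp_feasible_iff]
  have comb: "a - b + z - c \<le> 0"
    if "a = s * a1 + t * a2" "b = s * b1 + t * b2" "c = s * c1 + t * c2"
      "a1 - b1 + z - c1 \<le> 0" "a2 - b2 + z - c2 \<le> 0" for a b c z a1 a2 b1 b2 c1 c2 :: real
  proof -
    have "s * (a1 - b1 + z - c1) + t * (a2 - b2 + z - c2) \<le> 0"
      using st that by (intro add_nonpos_nonpos mult_nonneg_nonpos) auto
    moreover have "s * (a1 - b1 + z - c1) + t * (a2 - b2 + z - c2) = a - b + (s + t) * z - c"
      unfolding that by (simp add: algebra_simps)
    ultimately show ?thesis using st by simp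
  qed
  have form: "y \<bullet> ((s *\<^sub>R P + t *\<^sub>R P') *v y) = s * (y \<bullet> (P *v y)) + t * (y \<bullet> (P' *v y))" for y
    by (simp add: matrix_vector_mult_add_rdistrib inner_add_right scaleR_matrix_vector_assoc[symmetric])
  have "transpose (s *\<^sub>R P + t *\<^sub>R P') = s *\<^sub>R transpose P + t *\<^sub>R transpose P'"
    by (simp add: transpose_def vec_eq_iff)
  then have tr: "transpose (s *\<^sub>R P + t *\<^sub>R P') = s *\<^sub>R P + t *\<^sub>R P'"
    using p' q' by simp
  have sums: "(\<Sum>i\<in>UNIV. (s *\<^sub>R g + t *\<^sub>R g') $ i * f i)
      = s * (\<Sum>i\<in>UNIV. g $ i * f i) + t * (\<Sum>i\<in>UNIV. g' $ i * f i)" for f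
    by (simp add: sum.distrib sum_distrib_left distrib_right mult.assoc)
  have "(s *\<^sub>R g + t *\<^sub>R g', s *\<^sub>R P + t *\<^sub>R P') \<in> sdp_feasible Ba Da S ds"
    unfolding sdp_feasible_iff
  proof (intro conjI allI tr)
    show "0 \<le> (s *\<^sub>R g + t *\<^sub>R g') $ i" for i using p' q' st by simp
  qed (rule comb[OF form form sums p'[THEN conjunct2, THEN conjunct2, rule_format]
        q'[THEN conjunct2, THEN conjunct2, rule_format]])
  then show "s *\<^sub>R p + t *\<^sub>R q \<in> sdp_feasible Ba Da S ds" by (simp add: pe qe)
qed

section \<open>Strong duality for the sampled loops\<close>

theorem mainTheorem2:
  fixes \<Omega> :: "(real^'v) set"
    and S0 :: "('n::finite, 'c::finite, 'e::finite, 'u::finite, 'y::finite, 'p::finite, 'r::finite) loop"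
    and \<Delta> :: "real^'v \<Rightarrow> ('n, 'c, 'e, 'u, 'y, 'p, 'r) loop"
    and Ba :: "real^'a^'u" and Da :: "real^'a^'y"
    and S :: "real^'v \<Rightarrow> ('n, 'c, 'e, 'u, 'y, 'p, 'r) loop"
    and ds :: "'N::finite \<Rightarrow> real^'v"
  assumes "closed \<Omega>" and "bounded \<Omega>" and "0 \<in> \<Omega>"
    and "attack_channels Ba Da"
    and "\<Delta> 0 = zero_loop"
    and "\<And>\<delta>. S \<delta> = plus_loop S0 (\<Delta> \<delta>)"
    and "\<And>\<delta>. \<delta> \<in> \<Omega> \<Longrightarrow> asymp_stable (A_cl (S \<delta>))"
    and "\<And>\<delta>. \<delta> \<in> \<Omega> \<Longrightarrow> rank (B_cl Ba Da (S \<delta>)) = CARD('a)"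
    and "\<And>i. ds i \<in> \<Omega>"
  shows "convex (sdp_feasible Ba Da S ds) \<and>
    gamma_RA Ba Da S ds =
      (INF (g, P) \<in> sdp_feasible Ba Da S ds. ereal ((1 :: real^'N) \<bullet> g))"
proof
  show "convex (sdp_feasible Ba Da S ds)" by (rule convex_sdp_feasible)
next
  define A where "A = blkdiag (\<lambda>i. A_cl (S (ds i)))"
  define B where "B = vstack (\<lambda>i. B_cl Ba Da (S (ds i)))"
  define Cp where "Cp = blkdiag (\<lambda>i. C_p (S (ds i)))"
  define Dp where "Dp = vstack (\<lambda>i. D_p Ba Da (S (ds i)))"
  define C where "C = (\<lambda>i. blk i (blkdiag (\<lambda>i. C_r (S (ds i)))))"
  define D where "D = (\<lambda>i. blk i (vstack (\<lambda>i. D_r Ba Da (S (ds i)))))"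
  note sys_defs = A_def B_def Cp_def Dp_def C_def D_def
  let ?c = "1 / real CARD('N)" and ?F = "sdp_feasible Ba Da S ds"
  let ?obj = "INF (g, P) \<in> ?F. ereal ((1 :: real^'N) \<bullet> g)"
  have feas: "(g, P) \<in> ?F \<longleftrightarrow> (\<forall>i. 0 \<le> g $ i) \<and> transpose P = P \<and>
    (\<forall>x u. (A *v x + B *v u) \<bullet> (P *v (A *v x + B *v u)) - x \<bullet> (P *v x)
      + ?c * (norm (Cp *v x + Dp *v u))\<^sup>2
      - (\<Sum>i\<in>UNIV. g $ i * (norm (C i *v x + D i *v u))\<^sup>2) \<le> 0)" for g P
    unfolding sdp_feasible_iff sys_defs ..
  interpret attractive_system A B
  proof
    show "(\<lambda>k. ((*v) A ^^ k) x) \<longlonglongrightarrow> 0" for x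
      unfolding A_def using assms(7,9) by (intro attractive_blkdiag) (simp add: asymp_stable_def)
  qed
  have l2r: "l2_norm_sq (closed_loop_yr Ba Da (S (ds i)) a)
      = (\<Sum>k. ereal ((norm (outp A B (C i) (D i) 0 a k))\<^sup>2))" for a i
    by (simp add: sys_defs outp_blk l2_norm_sq_def closed_loop_yr_def power2_norm_eq_inner)
  have l2p: "(\<Sum>i\<in>UNIV. l2_norm_sq (closed_loop_yp Ba Da (S (ds i)) a))
      = (\<Sum>k. ereal ((norm (outp A B Cp Dp 0 a k))\<^sup>2))" for a
    by (simp only: sys_defs closed_loop_yp_def sum_l2_norm_sq_blocks)
  have blk_x: "closed_loop_x Ba Da (S (ds i)) a = (\<lambda>k. blk i (traj A B 0 a k))" for a i
    by (simp add: fun_eq_iff sys_defs closed_loop_x_def blk_traj blk_zero state_traj_eq_traj)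
  have l2e: "a \<in> l2e" for a :: "nat \<Rightarrow> real^'a" by (simp add: l2e_def)
  have stealthy: "a \<in> stealthy_attacks Ba Da S (range ds) \<longleftrightarrow>
      (\<forall>i. (\<Sum>k. ereal ((norm (outp A B (C i) (D i) 0 a k))\<^sup>2)) \<le> 1) \<and> traj A B 0 a \<longlonglongrightarrow> 0" for a
  proof -
    have "(\<lambda>k. blk i (traj A B 0 a k)) \<longlonglongrightarrow> 0" if "traj A B 0 a \<longlonglongrightarrow> 0" for i
      unfolding blk_def
      by (rule vec_tendstoI) (use tendsto_vec_nth[OF that] in simp)
    then have "(\<forall>i. (\<lambda>k. blk i (traj A B 0 a k)) \<longlonglongrightarrow> 0) \<longleftrightarrow> traj A B 0 a \<longlonglongrightarrow> 0"
      using tendsto_zero_blkI[of "traj A B 0 a"] by blast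
    then show ?thesis
      by (auto simp: stealthy_attacks_def l2e l2r blk_x)
  qed
  have gamma: "gamma_RA Ba Da S ds = (SUP a \<in> stealthy_attacks Ba Da S (range ds).
      ereal ?c * (\<Sum>k. ereal ((norm (outp A B Cp Dp 0 a k))\<^sup>2)))"
    unfolding gamma_RA_def l2p ..
  have weak: "gamma_RA Ba Da S ds \<le> ?obj"
    unfolding gamma
  proof (intro SUP_least INF_greatest)
    fix a p assume a: "a \<in> stealthy_attacks Ba Da S (range ds)" and p: "p \<in> ?F"
    obtain g P where pe: "p = (g, P)" by force
    have "ereal ?c * (\<Sum>k. ereal ((norm (outp A B Cp Dp 0 a k))\<^sup>2)) \<le> ereal (1 \<bullet> g)"
      using p[unfolded pe feas] a[unfolded stealthy] by (intro weak_duality) auto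
    then show "ereal ?c * (\<Sum>k. ereal ((norm (outp A B Cp Dp 0 a k))\<^sup>2))
        \<le> (case p of (g, P) \<Rightarrow> ereal (1 \<bullet> g))"
      by (simp add: pe)
  qed
  \<comment> \<open>Attractivity sends the state to \<open>0\<close> after a finite signal, so the
    residual bounds alone make such a signal stealthy.\<close>
  have fin: "ereal (?c * energy A B Cp Dp 0 u) \<le> gamma_RA Ba Da S ds"
    if u: "u \<in> finite_signals" "\<And>i. energy A B (C i) (D i) 0 u \<le> 1" for u
  proof -
    have "u \<in> stealthy_attacks Ba Da S (range ds)"
      using u traj_tendsto_0 by (simp add: stealthy suminf_ereal_energy)
    then show ?thesis unfolding gamma
      by (rule SUP_upper2) (simp add: suminf_ereal_energy[OF u(1)])
  qed
  show "gamma_RA Ba Da S ds = ?obj"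
  proof (cases "gamma_RA Ba Da S ds")
    case (real b)
    have "?c * energy A B Cp Dp 0 u \<le> b"
      if "u \<in> finite_signals" "\<And>i. energy A B (C i) (D i) 0 u \<le> 1" for u
      using fin[OF that] by (simp add: real)
    then obtain g :: "real^'N" where g: "\<And>i. g $ i \<ge> 0" "1 \<bullet> g \<le> b"
      "\<And>u. u \<in> finite_signals \<Longrightarrow>
        ?c * energy A B Cp Dp 0 u \<le> (\<Sum>i\<in>UNIV. g $ i * energy A B (C i) (D i) 0 u)"
      using stacked_multipliers[of ?c C D Cp Dp b] by auto
    have near: "?obj \<le> ereal ((1 + h)\<^sup>2 * b)" if h: "h > 0" for h
    proof -
      have "?c \<ge> 0" by simp
      from storage_matrix_exists[OF this g(1) h g(3)]
      obtain P where P: "transpose P = P"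
        "\<And>x u. (A *v x + B *v u) \<bullet> (P *v (A *v x + B *v u)) - x \<bullet> (P *v x)
          + ?c * (norm (Cp *v x + Dp *v u))\<^sup>2
          - (\<Sum>i\<in>UNIV. (1 + h)\<^sup>2 * g $ i * (norm (C i *v x + D i *v u))\<^sup>2) \<le> 0"
        by blast
      then have "((1 + h)\<^sup>2 *\<^sub>R g, P) \<in> ?F"
        unfolding feas using g(1) by simp
      then have "?obj \<le> ereal (1 \<bullet> ((1 + h)\<^sup>2 *\<^sub>R g))"
        by (rule INF_lower2) simp
      also have "\<dots> \<le> ereal ((1 + h)\<^sup>2 * b)" using g(2) by (simp add: mult_left_mono)
      finally show ?thesis .
    qed
    \<comment> \<open>Each inflation yields a feasible pair; the infimum absorbs the limit even if
      none is feasible at \<open>h = 0\<close>.\<close>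
    have "((\<lambda>h. ereal ((1 + h)\<^sup>2 * b)) \<longlongrightarrow> ereal ((1 + 0)\<^sup>2 * b)) (at_right 0)"
      by (intro tendsto_intros)
    then have "?obj \<le> ereal ((1 + 0)\<^sup>2 * b)"
      by (rule tendsto_lowerbound) (use near in \<open>auto simp: eventually_at_right_field intro!: exI[of _ 1]\<close>)
    then show ?thesis using weak by (simp add: real)
  next
    \<comment> \<open>Here weak duality makes the infimum infinite as well.\<close>
    case PInf
    then show ?thesis using weak by (simp add: top_ereal_def[symmetric] top_unique)
  next
    \<comment> \<open>Impossible, because the zero attack is stealthy and has loss
      \<open>0\<close>.\<close>
    case MInf
    then show ?thesis using fin[OF finite_signals_zero] by (simp add: energy_zero)
  qed
qed

end
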